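(* Let $\mathfrak g$ be a complex Lie algebra, let $0\to \mathbb C\xrightarrow{i}V_2\xrightarrow{d}V_3\to 0$ be a short exact sequence of $\mathfrak g$-modules with $\mathbb C$ the trivial module, let $\alpha\in Z^2(\mathfrak g,V_3)$ be a Chevalley--Eilenberg 2-cocycle, let $E=V_3\times_\alpha\mathfrak g$ be the corresponding abelian extension, and let $\mu:V_2\to E$, $\mu(v)=(d(v),0)$, be the resulting crossed module. Put $1_{V_2}=i(1)$. Let $Q:V_3\to V_2$ be a linear section of $d$, put $\omega=Q\circ\alpha:\Lambda^2\mathfrak g\to V_2$ and $\Phi=d_{CE}\omega:\Lambda^3\mathfrak g\to V_2$. Let $r=\sum_i s_i\otimes t_i\in\mathfrak g\otimes\mathfrak g$ be a symmetric $\mathfrak g$-invariant tensor, and suppose that for all $X,Y\in\mathfrak g$ $$\sum_i\Phi(s_i,X,Y)\otimes t_i=1_{V_2}\otimes[X,Y]\quad\text{and}\quad \sum_i s_i\otimes\Phi(t_i,X,Y)=[X,Y]\otimes 1_{V_2}.$$ For $X\in\mathfrak g$ and $h\in V_3$ write $\overline X=(0,X)\in E$ and $\overline h=(h,0)\in E$. Let $\overline r=\sum_i\overline{s}_i\otimes\overline{t}_i$, let $c\in\ker(\mu)=i(\mathbb C)$, and let $\xi:E\to(E\otimes V_2)\oplus(V_2\otimes E)$ be the linear map $\xi=-\xi_0-C$, where $\xi_0$ and $C$ are the linear maps given by $$\xi_0(\overline X)=\sum_i\big(\omega(s_i,X)\otimes\overline t_i+\overline s_i\otimes\omega(t_i,X)\big),$$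 $$\xi_0(\overline h)=\sum_i\big((s_i\cdot Q(h))\otimes\overline t_i+\overline s_i\otimes(t_i\cdot Q(h))\big),$$ $$C(h,X)=1_{V_2}\otimes\overline X+\overline X\otimes 1_{V_2}.$$ Then the triple $(\overline r,\xi,c)$ is a quasi-invariant tensor for the crossed module $\mu:V_2\to V_3\times_\alpha\mathfrak g$.
   Context: A crossed module of Lie algebras is a Lie algebra homomorphism $\mu:\mathfrak m\to\mathfrak n$ with an action of $\mathfrak n$ on $\mathfrak m$ by derivations such that $\mu(n\cdot m)=[n,\mu(m)]$ and $\mu(m)\cdot m'=[m,m']$. $V_3\times_\alpha\mathfrak g$ is the vector space $V_3\oplus\mathfrak g$ with bracket $[(h,X),(h',Y)]=(X\cdot h'-Y\cdot h+\alpha(X,Y),[X,Y])$. In $\mu:V_2\to E=V_3\times_\alpha\mathfrak g$, the space $V_2$ is an abelian Lie algebra and $E$ acts on $V_2$ via the projection $E\to\mathfrak g$. The Chevalley--Eilenberg coboundary is the standard one: $d_{CE}\omega(X,Y,Z)=X\cdot\omega(Y,Z)-Y\cdot\omega(X,Z)+Z\cdot\omega(X,Y)-\omega([X,Y],Z)+\omega([X,Z],Y)-\omega([Y,Z],X)$. Let $\mu:\mathfrak m\to\mathfrak n$ be a crossed module, $\mathfrak e=\mathfrak m\rtimes\mathfrak n$ the semidirect product, and $\beta:\mathfrak e\to\mathfrak n$ the Lie algebra morphism $\beta(v,X)=\mu(v)+X$, extended to algebra morphisms $\beta:U(\mathfrak e^{\oplus n})\to U(\mathfrak n^{\oplus n})$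 of universal enveloping algebras. Let $A_n\subset U(\mathfrak e^{\oplus n})$ be the smallest vector subspace containing all elements $xvy$ with $x,y\in U(\mathfrak n^{\oplus n})$, $v\in\mathfrak m^{\oplus n}$. The vector space $\mathcal U^{(n)}$ is the quotient of $A_n$ by the relations $x\mu(u)yvz=xuy\mu(v)z$ for all $x,y,z\in U(\mathfrak n^{\oplus n})$, $u,v\in\mathfrak m^{\oplus n}$. With $U(\mathfrak e\oplus\mathfrak e)=U(\mathfrak e)\otimes U(\mathfrak e)$, the space $(\mathfrak n\otimes\mathfrak m)\oplus(\mathfrak m\otimes\mathfrak n)$ is contained in $A_2$ and maps to $\mathcal U^{(2)}$. For $r=\sum_i s_i\otimes t_i\in\mathfrak n\otimes\mathfrak n$ and $u\in\mathfrak m$, set $u\cdot r=-\sum_i\big((s_i\cdot u)\otimes t_i+s_i\otimes(t_i\cdot u)\big)$. $\mathfrak n$ acts diagonally on $\mathfrak n\otimes\mathfrak n$, $\mathfrak n\otimes\mathfrak m$ and $\mathfrak m\otimes\mathfrak n$ (adjoint action on $\mathfrak n$, crossed module action on $\mathfrak m$). A quasi-invariant tensor in $\mu:\mathfrak m\to\mathfrak n$ consists of: a symmetric tensor $r\in\mathfrak n\otimes\mathfrak n$; a linear map $\xi:\mathfrak n\to(\mathfrak n\otimes\mathfrak m)\oplus(\mathfrak m\otimes\mathfrak n)$ with symmetric image (each $\xi(X)$ is invariant under the flip of the two tensor factors); and an $\mathfrak n$-invariant element $c\in\ker(\mu)\subset\mathfrak m$; such that (a) $X\cdot r=\beta(\xi(X))$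 for all $X\in\mathfrak n$; (b) $u\cdot r=\xi(\mu(u))$ for all $u\in\mathfrak m$; (c) $\xi([X,Y])=X\cdot\xi(Y)-Y\cdot\xi(X)$ for all $X,Y\in\mathfrak n$; where (a) is an equality in $\mathfrak n\otimes\mathfrak n$ and (b), (c) are equalities in $\mathcal U^{(2)}$. *)

theory Defs
  imports
    "HOL-Analysis.Finite_Cartesian_Product"
    "HOL-Analysis.Product_Vector"
    "HOL-Algebra.QuotRing"
    "HOL-Algebra.Module"
    "HOL-Library.Poly_Mapping"
begin

section \<open>Complex vector spaces\<close>

class complex_vector = ab_group_add +
  fixes scaleC :: "complex \<Rightarrow> 'a \<Rightarrow> 'a"  (infixr \<open>*\<^sub>C\<close> 75)
  assumes scaleC_add_right: "a *\<^sub>C (x + y) = a *\<^sub>C x + a *\<^sub>C y"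
    and scaleC_add_left: "(a + b) *\<^sub>C x = a *\<^sub>C x + b *\<^sub>C x"
    and scaleC_scaleC: "a *\<^sub>C (b *\<^sub>C x) = (a * b) *\<^sub>C x"
    and scaleC_one: "1 *\<^sub>C x = x"

global_interpretation cvs: vector_space "scaleC :: complex \<Rightarrow> 'a \<Rightarrow> 'a::complex_vector"
  by unfold_locales (simp_all add: scaleC_add_right scaleC_add_left scaleC_scaleC scaleC_one)

abbreviation clinear :: "('a::complex_vector \<Rightarrow> 'b::complex_vector) \<Rightarrow> bool"
  where "clinear \<equiv> Vector_Spaces.linear scaleC scaleC"

definition cbilinear :: "('a::complex_vector \<Rightarrow> 'b::complex_vector \<Rightarrow> 'c::complex_vector) \<Rightarrow> bool"
  where "cbilinear f \<longleftrightarrow> (\<forall>x. clinear (f x)) \<and> (\<forall>y. clinear (\<lambda>x. f x y))"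

instantiation complex :: complex_vector
begin
definition "scaleC c (z::complex) = c * z"
instance by standard (simp_all add: scaleC_complex_def algebra_simps)
end

instantiation prod :: (complex_vector, complex_vector) complex_vector
begin
definition "scaleC c p = (c *\<^sub>C fst p, c *\<^sub>C snd p)"
instance
  by standard (simp_all add: scaleC_prod_def prod_eq_iff scaleC_add_right scaleC_add_left
    scaleC_scaleC scaleC_one)
end

instantiation vec :: (complex_vector, finite) complex_vector
begin
definition "scaleC c v = (\<chi> i. c *\<^sub>C (v $ i))"
instance
  by standard (simp_all add: scaleC_vec_def vec_eq_iff scaleC_add_right scaleC_add_left
    scaleC_scaleC scaleC_one)
end

instantiation poly_mapping :: (type, complex_vector) complex_vector
begin
definition "scaleC c p = Poly_Mapping.map (scaleC c) p"
lemma lookup_scaleC: "Poly_Mapping.lookup (c *\<^sub>C p) k = c *\<^sub>C Poly_Mapping.lookup p k"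
  by (simp add: scaleC_poly_mapping_def map.rep_eq when_def)
instance
  by standard (rule poly_mapping_eqI, simp add: lookup_scaleC lookup_add scaleC_add_right
    scaleC_add_left scaleC_scaleC scaleC_one)+
end


section \<open>Tensor product of complex vector spaces\<close>

text \<open>
  The tensor product is the vector space with basis the set of all pairs \<open>(a, b)\<close>, modulo the
  subspace spanned by the bilinearity relations.
\<close>

definition tensor_relators :: "(('a::complex_vector \<times> 'b::complex_vector) \<Rightarrow>\<^sub>0 complex) set"
  where "tensor_relators =
    {Poly_Mapping.single (a + a', b) 1 - Poly_Mapping.single (a, b) 1
       - Poly_Mapping.single (a', b) 1 | a a' b. True} \<union>
    {Poly_Mapping.single (a, b + b') 1 - Poly_Mapping.single (a, b) 1
       - Poly_Mapping.single (a, b') 1 | a b b'. True} \<union>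
    {Poly_Mapping.single (z *\<^sub>C a, b) 1 - Poly_Mapping.single (a, b) z | z a b. True} \<union>
    {Poly_Mapping.single (a, z *\<^sub>C b) 1 - Poly_Mapping.single (a, b) z | z a b. True}"

definition tensor_rel ::
  "(('a::complex_vector \<times> 'b::complex_vector) \<Rightarrow>\<^sub>0 complex) \<Rightarrow> (('a \<times> 'b) \<Rightarrow>\<^sub>0 complex) \<Rightarrow> bool"
  where "tensor_rel p q \<longleftrightarrow> p - q \<in> cvs.span tensor_relators"

lemma equivp_tensor_rel: "equivp tensor_rel"
proof (rule equivpI)
  show "reflp tensor_rel"
    by (auto intro!: reflpI simp: tensor_rel_def cvs.span_zero)
  show "symp tensor_rel"
    unfolding tensor_rel_def by (rule sympI, drule cvs.span_neg) simp
  show "transp tensor_rel"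
    unfolding tensor_rel_def by (rule transpI, drule (1) cvs.span_add) simp
qed

quotient_type (overloaded) ('a, 'b) tensor =
  "('a::complex_vector \<times> 'b::complex_vector) \<Rightarrow>\<^sub>0 complex" / tensor_rel
  by (rule equivp_tensor_rel)

type_notation tensor (infixr \<open>\<otimes>\<^sub>V\<close> 25)

instantiation tensor :: (complex_vector, complex_vector) complex_vector
begin

lift_definition zero_tensor :: "'a \<otimes>\<^sub>V 'b" is 0 .

lift_definition plus_tensor :: "('a \<otimes>\<^sub>V 'b) \<Rightarrow> ('a \<otimes>\<^sub>V 'b) \<Rightarrow> ('a \<otimes>\<^sub>V 'b)" is "(+)"
  unfolding tensor_rel_def by (simp only: add_diff_add) (rule cvs.span_add)

lift_definition minus_tensor :: "('a \<otimes>\<^sub>V 'b) \<Rightarrow> ('a \<otimes>\<^sub>V 'b) \<Rightarrow> ('a \<otimes>\<^sub>V 'b)" is "(-)"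
proof -
  fix p p' q q' :: "('a \<times> 'b) \<Rightarrow>\<^sub>0 complex"
  assume "tensor_rel p p'" and "tensor_rel q q'"
  then have "(p - p') - (q - q') \<in> cvs.span tensor_relators"
    unfolding tensor_rel_def by (rule cvs.span_diff)
  moreover have "(p - p') - (q - q') = (p - q) - (p' - q')"
    by simp
  ultimately show "tensor_rel (p - q) (p' - q')"
    unfolding tensor_rel_def by simp
qed

lift_definition uminus_tensor :: "('a \<otimes>\<^sub>V 'b) \<Rightarrow> ('a \<otimes>\<^sub>V 'b)" is uminus
  unfolding tensor_rel_def by (simp only: minus_diff_minus) (rule cvs.span_neg)

lift_definition scaleC_tensor :: "complex \<Rightarrow> ('a \<otimes>\<^sub>V 'b) \<Rightarrow> ('a \<otimes>\<^sub>V 'b)" is scaleC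
  unfolding tensor_rel_def
  by (simp only: cvs.scale_right_diff_distrib[symmetric]) (rule cvs.span_scale)

instance
  by standard (transfer, simp add: tensor_rel_def cvs.span_zero scaleC_add_right
    scaleC_add_left scaleC_scaleC scaleC_one algebra_simps)+

end

lift_definition tmult :: "'a::complex_vector \<Rightarrow> 'b::complex_vector \<Rightarrow> 'a \<otimes>\<^sub>V 'b"
    (infixr \<open>\<otimes>\<^sub>t\<close> 72)
  is "\<lambda>a b. Poly_Mapping.single (a, b) 1" .

text \<open>
  The linear map on the tensor product induced by a bilinear map \<open>f\<close>. It is defined by evaluating
  \<open>f\<close> on a chosen representative; if \<open>f\<close> is bilinear, the result does not depend on that choice
  (see \<open>tensor_lift_tmult\<close> and \<open>clinear_tensor_lift\<close> below).
\<close>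

definition eval_formal :: "('a \<Rightarrow> 'b \<Rightarrow> 'c::complex_vector) \<Rightarrow> (('a \<times> 'b) \<Rightarrow>\<^sub>0 complex) \<Rightarrow> 'c"
  where "eval_formal f p = (\<Sum>(a, b)\<in>Poly_Mapping.keys p. Poly_Mapping.lookup p (a, b) *\<^sub>C f a b)"

definition tensor_lift ::
  "('a::complex_vector \<Rightarrow> 'b::complex_vector \<Rightarrow> 'c::complex_vector) \<Rightarrow> ('a \<otimes>\<^sub>V 'b) \<Rightarrow> 'c"
  where "tensor_lift f t = eval_formal f (rep_tensor t)"

lemma eval_formal_superset:
  assumes "finite S" and "Poly_Mapping.keys p \<subseteq> S"
  shows "eval_formal f p = (\<Sum>(a, b)\<in>S. Poly_Mapping.lookup p (a, b) *\<^sub>C f a b)"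
  unfolding eval_formal_def
  by (rule sum.mono_neutral_left) (use assms in \<open>auto simp: in_keys_iff\<close>)

lemma eval_formal_add: "eval_formal f (p + q) = eval_formal f p + eval_formal f q"
proof -
  let ?S = "Poly_Mapping.keys p \<union> Poly_Mapping.keys q"
  have "eval_formal f (p + q) = (\<Sum>(a, b)\<in>?S. Poly_Mapping.lookup (p + q) (a, b) *\<^sub>C f a b)"
    by (rule eval_formal_superset) (use Poly_Mapping.keys_add[of p q] in auto)
  also have "\<dots> = (\<Sum>(a, b)\<in>?S. Poly_Mapping.lookup p (a, b) *\<^sub>C f a b)
                   + (\<Sum>(a, b)\<in>?S. Poly_Mapping.lookup q (a, b) *\<^sub>C f a b)"
    by (simp add: lookup_add scaleC_add_left sum.distrib split_def)
  also have "\<dots> = eval_formal f p + eval_formal f q"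
    by (simp add: eval_formal_superset[of ?S])
  finally show ?thesis .
qed

lemma eval_formal_scale: "eval_formal f (z *\<^sub>C p) = z *\<^sub>C eval_formal f p"
proof -
  have "eval_formal f (z *\<^sub>C p)
      = (\<Sum>(a, b)\<in>Poly_Mapping.keys p. Poly_Mapping.lookup (z *\<^sub>C p) (a, b) *\<^sub>C f a b)"
    by (rule eval_formal_superset) (auto simp: in_keys_iff lookup_scaleC)
  also have "\<dots> = z *\<^sub>C eval_formal f p"
    by (simp add: eval_formal_def lookup_scaleC scaleC_complex_def split_def
        cvs.scale_sum_right scaleC_scaleC)
  finally show ?thesis .
qed

lemma clinear_iff:
  "clinear f \<longleftrightarrow> (\<forall>x y. f (x + y) = f x + f y) \<and> (\<forall>z x. f (z *\<^sub>C x) = z *\<^sub>C f x)"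
  unfolding Vector_Spaces.linear_iff by (simp add: cvs.vector_space_axioms)

lemma clinear_eval_formal: "clinear (eval_formal f)"
  by (simp add: clinear_iff eval_formal_add eval_formal_scale)

lemma eval_formal_single: "eval_formal f (Poly_Mapping.single (a, b) z) = z *\<^sub>C f a b"
  by (simp add: eval_formal_def)

lemma eval_formal_cong:
  assumes "cbilinear f" and "tensor_rel p q"
  shows "eval_formal f p = eval_formal f q"
proof -
  interpret l: Vector_Spaces.linear scaleC scaleC "eval_formal f"
    by (rule clinear_eval_formal)
  have "p - q \<in> cvs.span tensor_relators"
    using assms(2) by (simp add: tensor_rel_def)
  then have "eval_formal f (p - q) = 0"
  proof (induction rule: cvs.span_induct_alt)
    case base
    show ?case by (simp add: l.zero)
  next
    case (step z x y)
    have "eval_formal f x = 0"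
      using step(1) assms(1)
      by (auto simp: tensor_relators_def l.diff eval_formal_single cbilinear_def clinear_iff
          scaleC_one)
    with step show ?case by (simp add: l.add l.scale)
  qed
  then show ?thesis by (simp add: l.diff)
qed

lemma tensor_rel_rep: "tensor_rel (rep_tensor (abs_tensor p)) p"
  by (rule Quotient3_rep_abs[OF Quotient3_tensor]) (simp add: equivp_reflp[OF equivp_tensor_rel])

lemma tensor_lift_abs:
  assumes "cbilinear f"
  shows "tensor_lift f (abs_tensor p) = eval_formal f p"
  unfolding tensor_lift_def by (rule eval_formal_cong[OF assms tensor_rel_rep])

lemma tensor_lift_tmult:
  assumes "cbilinear f"
  shows "tensor_lift f (a \<otimes>\<^sub>t b) = f a b"
  using tensor_lift_abs[OF assms]
  by (simp add: tmult.abs_eq eval_formal_single scaleC_one)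

lemma clinear_tensor_lift:
  assumes "cbilinear f"
  shows "clinear (tensor_lift f)"
  unfolding clinear_iff
proof (intro conjI allI)
  fix s t :: "'a \<otimes>\<^sub>V 'b" and z
  obtain p q where "s = abs_tensor p" and "t = abs_tensor q"
    by (metis Quotient3_abs_rep[OF Quotient3_tensor])
  then show "tensor_lift f (s + t) = tensor_lift f s + tensor_lift f t"
    and "tensor_lift f (z *\<^sub>C s) = z *\<^sub>C tensor_lift f s"
    by (simp_all add: plus_tensor.abs_eq scaleC_tensor.abs_eq tensor_lift_abs[OF assms]
        eval_formal_add eval_formal_scale)
qed

definition tensor_map ::
  "('a::complex_vector \<Rightarrow> 'c::complex_vector) \<Rightarrow> ('b::complex_vector \<Rightarrow> 'd::complex_vector) \<Rightarrow>
   ('a \<otimes>\<^sub>V 'b) \<Rightarrow> ('c \<otimes>\<^sub>V 'd)"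
  where "tensor_map f g = tensor_lift (\<lambda>a b. f a \<otimes>\<^sub>t g b)"

definition tensor_flip :: "('a::complex_vector \<otimes>\<^sub>V 'b::complex_vector) \<Rightarrow> ('b \<otimes>\<^sub>V 'a)"
  where "tensor_flip = tensor_lift (\<lambda>a b. b \<otimes>\<^sub>t a)"

definition diag_act ::
  "('a::complex_vector \<Rightarrow> 'a) \<Rightarrow> ('b::complex_vector \<Rightarrow> 'b) \<Rightarrow> ('a \<otimes>\<^sub>V 'b) \<Rightarrow> ('a \<otimes>\<^sub>V 'b)"
  where "diag_act f g = tensor_lift (\<lambda>a b. f a \<otimes>\<^sub>t b + a \<otimes>\<^sub>t g b)"


section \<open>Lie algebras, modules, crossed modules\<close>

text \<open>The bracket is an explicit parameter, since one carrier type bears many brackets.\<close>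

locale lie_algebra =
  fixes br :: "'a::complex_vector \<Rightarrow> 'a \<Rightarrow> 'a"
  assumes bilinear: "cbilinear br"
    and alternating: "br x x = 0"
    and jacobi: "br x (br y z) + br y (br z x) + br z (br x y) = 0"

locale lie_module = lie_algebra br
  for br :: "'a::complex_vector \<Rightarrow> 'a \<Rightarrow> 'a" +
  fixes act :: "'a \<Rightarrow> 'v::complex_vector \<Rightarrow> 'v"
  assumes act_bilinear: "cbilinear act"
    and act_bracket: "act (br x y) v = act x (act y v) - act y (act x v)"

definition lie_module_hom :: "('a \<Rightarrow> 'v::complex_vector \<Rightarrow> 'v) \<Rightarrow> ('a \<Rightarrow> 'w::complex_vector \<Rightarrow> 'w) \<Rightarrow>
    ('v \<Rightarrow> 'w) \<Rightarrow> bool"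
  where "lie_module_hom act act' f \<longleftrightarrow> clinear f \<and> (\<forall>x v. f (act x v) = act' x (f v))"

definition lie_hom :: "('a::complex_vector \<Rightarrow> 'a \<Rightarrow> 'a) \<Rightarrow> ('b::complex_vector \<Rightarrow> 'b \<Rightarrow> 'b) \<Rightarrow>
    ('a \<Rightarrow> 'b) \<Rightarrow> bool"
  where "lie_hom br br' f \<longleftrightarrow> clinear f \<and> (\<forall>x y. f (br x y) = br' (f x) (f y))"

definition ce_d2 :: "('a::complex_vector \<Rightarrow> 'a \<Rightarrow> 'a) \<Rightarrow> ('a \<Rightarrow> 'v::complex_vector \<Rightarrow> 'v) \<Rightarrow>
    ('a \<Rightarrow> 'a \<Rightarrow> 'v) \<Rightarrow> 'a \<Rightarrow> 'a \<Rightarrow> 'a \<Rightarrow> 'v"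
  where "ce_d2 br act w x y z =
    act x (w y z) - act y (w x z) + act z (w x y)
      - w (br x y) z + w (br x z) y - w (br y z) x"

definition ce_cocycle2 :: "('a::complex_vector \<Rightarrow> 'a \<Rightarrow> 'a) \<Rightarrow> ('a \<Rightarrow> 'v::complex_vector \<Rightarrow> 'v) \<Rightarrow>
    ('a \<Rightarrow> 'a \<Rightarrow> 'v) \<Rightarrow> bool"
  where "ce_cocycle2 br act w \<longleftrightarrow>
    cbilinear w \<and> (\<forall>x. w x x = 0) \<and> (\<forall>x y z. ce_d2 br act w x y z = 0)"

definition abelian_ext :: "('a::complex_vector \<Rightarrow> 'a \<Rightarrow> 'a) \<Rightarrow> ('a \<Rightarrow> 'v::complex_vector \<Rightarrow> 'v) \<Rightarrow>
    ('a \<Rightarrow> 'a \<Rightarrow> 'v) \<Rightarrow> 'v \<times> 'a \<Rightarrow> 'v \<times> 'a \<Rightarrow> 'v \<times> 'a"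
  where "abelian_ext br act w = (\<lambda>(h, X) (h', Y). (act X h' - act Y h + w X Y, br X Y))"

definition semidirect :: "('m::complex_vector \<Rightarrow> 'm \<Rightarrow> 'm) \<Rightarrow> ('n::complex_vector \<Rightarrow> 'n \<Rightarrow> 'n) \<Rightarrow>
    ('n \<Rightarrow> 'm \<Rightarrow> 'm) \<Rightarrow> 'm \<times> 'n \<Rightarrow> 'm \<times> 'n \<Rightarrow> 'm \<times> 'n"
  where "semidirect brm brn act =
    (\<lambda>(u, X) (v, Y). (brm u v + act X v - act Y u, brn X Y))"

text \<open>The direct sum of copies of a Lie algebra indexed by \<open>'i\<close>.\<close>

definition pow_bracket :: "('a \<Rightarrow> 'a \<Rightarrow> 'a) \<Rightarrow> 'a ^ 'i \<Rightarrow> 'a ^ 'i \<Rightarrow> 'a ^ 'i::finite"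
  where "pow_bracket br x y = (\<chi> i. br (x $ i) (y $ i))"


section \<open>Universal enveloping algebras\<close>

definition type_ring :: "'a::ring_1 ring"
  where "type_ring = \<lparr>carrier = UNIV, mult = (*), one = 1, zero = 0, add = (+)\<rparr>"

text \<open>
  The monoid algebra of the free monoid on \<open>'a\<close> is the free associative algebra on the set \<open>'a\<close>.
  The universal enveloping algebra is its quotient by the two-sided ideal that makes the generators
  depend linearly on their labels and turns commutators into brackets.
\<close>

datatype 'a fword = FWord "'a list"

instantiation fword :: (type) monoid_add
begin
definition "0 = FWord []"
fun plus_fword :: "'a fword \<Rightarrow> 'a fword \<Rightarrow> 'a fword"
  where "FWord u + FWord v = FWord (u @ v)"
instance
proof
  fix a b c :: "'a fword"
  show "a + b + c = a + (b + c)" by (cases a; cases b; cases c) simp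
  show "0 + a = a" by (cases a) (simp add: zero_fword_def)
  show "a + 0 = a" by (cases a) (simp add: zero_fword_def)
qed
end

type_synonym 'a free_alg = "'a fword \<Rightarrow>\<^sub>0 complex"

abbreviation free_ring :: "'a free_alg ring"
  where "free_ring \<equiv> type_ring"

definition fgen :: "'a \<Rightarrow> 'a free_alg"
  where "fgen x = Poly_Mapping.single (FWord [x]) 1"

definition fconst :: "complex \<Rightarrow> 'a free_alg"
  where "fconst z = Poly_Mapping.single 0 z"

definition free_map :: "('a \<Rightarrow> 'b) \<Rightarrow> 'a free_alg \<Rightarrow> 'b free_alg"
  where "free_map f p =
    (\<Sum>w\<in>Poly_Mapping.keys p. Poly_Mapping.single (map_fword f w) (Poly_Mapping.lookup p w))"

definition uea_relators :: "('a::complex_vector \<Rightarrow> 'a \<Rightarrow> 'a) \<Rightarrow> 'a free_alg set"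
  where "uea_relators br =
    {fgen (x + y) - fgen x - fgen y | x y. True} \<union>
    {fgen (z *\<^sub>C x) - fconst z * fgen x | z x. True} \<union>
    {fgen x * fgen y - fgen y * fgen x - fgen (br x y) | x y. True}"

definition uea_ideal :: "('a::complex_vector \<Rightarrow> 'a \<Rightarrow> 'a) \<Rightarrow> 'a free_alg set"
  where "uea_ideal br = genideal free_ring (uea_relators br)"

definition uea_class :: "('a::complex_vector \<Rightarrow> 'a \<Rightarrow> 'a) \<Rightarrow> 'a free_alg \<Rightarrow> 'a free_alg set"
  where "uea_class br p = uea_ideal br +>\<^bsub>free_ring\<^esub> p"

definition uea :: "('a::complex_vector \<Rightarrow> 'a \<Rightarrow> 'a) \<Rightarrow> (complex, 'a free_alg set) module"
  where "uea br = ring.extend (free_ring Quot uea_ideal br)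
    (module.fields (\<lambda>z. mult (free_ring Quot uea_ideal br) (uea_class br (fconst z))))"

definition uea_gen :: "('a::complex_vector \<Rightarrow> 'a \<Rightarrow> 'a) \<Rightarrow> 'a \<Rightarrow> 'a free_alg set"
  where "uea_gen br x = uea_class br (fgen x)"

text \<open>
  The algebra morphism into the enveloping algebra for \<open>br'\<close> that is induced by a Lie algebra
  morphism \<open>f\<close>; it maps the class of \<open>p\<close> to the class of \<open>free_map f p\<close>.
\<close>

definition uea_map :: "('b::complex_vector \<Rightarrow> 'b \<Rightarrow> 'b) \<Rightarrow> ('a \<Rightarrow> 'b) \<Rightarrow>
    'a free_alg set \<Rightarrow> 'b free_alg set"
  where "uea_map br' f c = the_elem ((\<lambda>p. uea_class br' (free_map f p)) ` c)"

text \<open>The smallest vector subspace of the enveloping algebra containing a given set.\<close>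

definition uea_span :: "('a::complex_vector \<Rightarrow> 'a \<Rightarrow> 'a) \<Rightarrow> 'a free_alg set set \<Rightarrow>
    'a free_alg set set"
  where "uea_span br S =
    \<Inter>{W. submodule W (type_ring :: complex ring) (uea br) \<and> S \<subseteq> W}"

text \<open>
  The inclusion of \<open>\<ee> \<otimes> \<ee>\<close> into the enveloping algebra of \<open>\<ee> \<oplus> \<ee>\<close>, sending \<open>x \<otimes> y\<close> to the product
  of \<open>(x, 0)\<close> and \<open>(0, y)\<close>. The product in the free algebra below is bilinear only modulo the
  ideal, so a representative is evaluated first and then its class is taken.
\<close>

definition uea_tensor :: "('a::complex_vector \<Rightarrow> 'a \<Rightarrow> 'a) \<Rightarrow> ('a \<otimes>\<^sub>V 'a) \<Rightarrow> ('a ^ 2) free_alg set"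
  where "uea_tensor br t =
    uea_class (pow_bracket br) (tensor_lift (\<lambda>x y. fgen (axis 0 x) * fgen (axis 1 y)) t)"


section \<open>Crossed modules and quasi-invariant tensors\<close>

locale crossed_module =
  M: lie_algebra brm + lie_module brn act
  for brm :: "'m::complex_vector \<Rightarrow> 'm \<Rightarrow> 'm"
    and brn :: "'n::complex_vector \<Rightarrow> 'n \<Rightarrow> 'n"
    and act :: "'n \<Rightarrow> 'm \<Rightarrow> 'm" +
  fixes \<mu> :: "'m \<Rightarrow> 'n"
  assumes act_derivation: "act X (brm u v) = brm (act X u) v + brm u (act X v)"
    and mu_hom: "lie_hom brm brn \<mu>"
    and mu_act: "\<mu> (act X u) = brn X (\<mu> u)"
    and act_mu: "act (\<mu> u) v = brm u v"
begin

abbreviation bre :: "'m \<times> 'n \<Rightarrow> 'm \<times> 'n \<Rightarrow> 'm \<times> 'n"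
  where "bre \<equiv> semidirect brm brn act"

definition \<beta> :: "'m \<times> 'n \<Rightarrow> 'n"
  where "\<beta> = (\<lambda>(v, X). \<mu> v + X)"

abbreviation U_e :: "(complex, (('m \<times> 'n) ^ 'i::finite) free_alg set) module"
  where "U_e \<equiv> uea (pow_bracket bre)"

text \<open>
  \<open>U_n\<close> is the enveloping algebra of the sum of copies of \<open>\<nn>\<close>, seen inside \<open>U_e\<close>; \<open>gen_m\<close> is the
  inclusion of the sum of copies of \<open>\<mm>\<close>, and \<open>gen_mu\<close> is \<open>\<mu>\<close> followed by the inclusion of the sum
  of copies of \<open>\<nn>\<close>.
\<close>

definition U_n :: "(('m \<times> 'n) ^ 'i::finite) free_alg set set"
  where "U_n = uea_map (pow_bracket bre) (\<lambda>X :: 'n ^ 'i. \<chi> i. (0, X $ i))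
    ` carrier (uea (pow_bracket brn))"

definition gen_m :: "'m ^ 'i \<Rightarrow> (('m \<times> 'n) ^ 'i::finite) free_alg set"
  where "gen_m u = uea_gen (pow_bracket bre) (\<chi> i. (u $ i, 0))"

definition gen_mu :: "'m ^ 'i \<Rightarrow> (('m \<times> 'n) ^ 'i::finite) free_alg set"
  where "gen_mu u = uea_gen (pow_bracket bre) (\<chi> i. (0, \<mu> (u $ i)))"

definition A_space :: "(('m \<times> 'n) ^ 'i::finite) free_alg set set"
  where "A_space = uea_span (pow_bracket bre)
    {x \<otimes>\<^bsub>U_e\<^esub> gen_m v \<otimes>\<^bsub>U_e\<^esub> y | x v y. x \<in> U_n \<and> y \<in> U_n}"

definition U_relations :: "(('m \<times> 'n) ^ 'i::finite) free_alg set set"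
  where "U_relations = uea_span (pow_bracket bre)
    {(x \<otimes>\<^bsub>U_e\<^esub> gen_mu u \<otimes>\<^bsub>U_e\<^esub> y \<otimes>\<^bsub>U_e\<^esub> gen_m v \<otimes>\<^bsub>U_e\<^esub> z)
        \<ominus>\<^bsub>U_e\<^esub> (x \<otimes>\<^bsub>U_e\<^esub> gen_m u \<otimes>\<^bsub>U_e\<^esub> y \<otimes>\<^bsub>U_e\<^esub> gen_mu v \<otimes>\<^bsub>U_e\<^esub> z)
      | x u y v z. x \<in> U_n \<and> y \<in> U_n \<and> z \<in> U_n}"

text \<open>
  The space \<open>\<U>\<close> with as many factors as \<open>'i\<close> has elements, as an additive group whose elements
  are cosets in \<open>A_space\<close>, and the projection onto it.
\<close>

definition U_space :: "(('m \<times> 'n) ^ 'i::finite) free_alg set set monoid"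
  where "U_space = (U_e\<lparr>carrier := A_space\<rparr>) A_Mod U_relations"

definition U_proj :: "(('m \<times> 'n) ^ 'i::finite) free_alg set \<Rightarrow>
    (('m \<times> 'n) ^ 'i) free_alg set set"
  where "U_proj a = U_relations +>\<^bsub>U_e\<lparr>carrier := A_space\<rparr>\<^esub> a"

text \<open>
  \<open>emb\<close> includes \<open>(\<nn> \<otimes> \<mm>) \<oplus> (\<mm> \<otimes> \<nn>)\<close> into \<open>\<ee> \<otimes> \<ee>\<close>. On \<open>\<ee> \<otimes> \<ee>\<close> the extension of \<open>\<beta>\<close> to
  enveloping algebras is \<open>\<beta> \<otimes> \<beta>\<close>, with values in \<open>\<nn> \<otimes> \<nn>\<close>.
\<close>

definition emb :: "('n \<otimes>\<^sub>V 'm) \<times> ('m \<otimes>\<^sub>V 'n) \<Rightarrow> ('m \<times> 'n) \<otimes>\<^sub>V ('m \<times> 'n)"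
  where "emb = (\<lambda>(a, b). tensor_map (\<lambda>X. (0, X)) (\<lambda>u. (u, 0)) a
                        + tensor_map (\<lambda>u. (u, 0)) (\<lambda>X. (0, X)) b)"

definition beta_sum :: "('n \<otimes>\<^sub>V 'm) \<times> ('m \<otimes>\<^sub>V 'n) \<Rightarrow> 'n \<otimes>\<^sub>V 'n"
  where "beta_sum w = tensor_map \<beta> \<beta> (emb w)"

definition to_U2 :: "('n \<otimes>\<^sub>V 'm) \<times> ('m \<otimes>\<^sub>V 'n) \<Rightarrow> (('m \<times> 'n) ^ 2) free_alg set set"
  where "to_U2 w = U_proj (uea_tensor bre (emb w))"

definition flip_sum :: "('n \<otimes>\<^sub>V 'm) \<times> ('m \<otimes>\<^sub>V 'n) \<Rightarrow> ('n \<otimes>\<^sub>V 'm) \<times> ('m \<otimes>\<^sub>V 'n)"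
  where "flip_sum = (\<lambda>(a, b). (tensor_flip b, tensor_flip a))"

definition act_sum :: "'n \<Rightarrow> ('n \<otimes>\<^sub>V 'm) \<times> ('m \<otimes>\<^sub>V 'n) \<Rightarrow> ('n \<otimes>\<^sub>V 'm) \<times> ('m \<otimes>\<^sub>V 'n)"
  where "act_sum X = (\<lambda>(a, b). (diag_act (brn X) (act X) a, diag_act (act X) (brn X) b))"

definition m_dot :: "'m \<Rightarrow> ('n \<otimes>\<^sub>V 'n) \<Rightarrow> ('n \<otimes>\<^sub>V 'm) \<times> ('m \<otimes>\<^sub>V 'n)"
  where "m_dot u r = - tensor_lift (\<lambda>s t. (s \<otimes>\<^sub>t act t u, act s u \<otimes>\<^sub>t t)) r"

end

locale quasi_invariant_tensor = crossed_module brm brn act \<mu>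
  for brm :: "'m::complex_vector \<Rightarrow> 'm \<Rightarrow> 'm"
    and brn :: "'n::complex_vector \<Rightarrow> 'n \<Rightarrow> 'n"
    and act :: "'n \<Rightarrow> 'm \<Rightarrow> 'm"
    and \<mu> :: "'m \<Rightarrow> 'n" +
  fixes r :: "'n \<otimes>\<^sub>V 'n"
    and \<xi> :: "'n \<Rightarrow> ('n \<otimes>\<^sub>V 'm) \<times> ('m \<otimes>\<^sub>V 'n)"
    and c :: 'm
  assumes r_symmetric: "tensor_flip r = r"
    and xi_linear: "clinear \<xi>"
    and xi_symmetric: "flip_sum (\<xi> X) = \<xi> X"
    and c_invariant: "act X c = 0"
    and c_ker: "\<mu> c = 0"
    and quasi_a: "diag_act (brn X) (brn X) r = beta_sum (\<xi> X)"
    and quasi_b: "to_U2 (m_dot u r) = to_U2 (\<xi> (\<mu> u))"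
    and quasi_c: "to_U2 (\<xi> (brn X Y)) = to_U2 (act_sum X (\<xi> Y) - act_sum Y (\<xi> X))"

end

theory Submission
  imports Defs
begin

text \<open>
  For \<open>e = (h, X)\<close> put \<open>\<theta> e w = \<omega>(w, X) + w \<cdot> Q h\<close>. Then \<open>\<xi>\<close> sends \<open>e\<close> to
  \<open>- \<Sum> (s \<otimes> \<theta> e t + \<theta> e s \<otimes> t) - X \<otimes> 1 - 1 \<otimes> X\<close>, and \<open>[e, w] = [X, w] - \<mu> (\<theta> e w)\<close> in \<open>E\<close> for
  \<open>w\<close> in \<open>\<gg>\<close>. Together with the invariance of \<open>r\<close> this gives (a), and (b) holds because
  \<open>Q (d u) - u\<close> lies in the trivial submodule. For (c) with \<open>e' = (h', Y)\<close>, the expression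
  \<open>\<theta> e' [X, w] - X \<cdot> \<theta> e' w - \<theta> e [Y, w] + Y \<cdot> \<theta> e w\<close> equals \<open>\<Phi>(w, X, Y) - \<theta> [e, e'] w\<close>, so by the
  hypotheses on \<open>\<Phi>\<close> the two sides differ by a sum of tensors \<open>\<mu> u \<otimes> v - u \<otimes> \<mu> v\<close>,
  which vanish in the quotient defining \<open>\<U>\<close>.
\<close>

section \<open>Tensor products\<close>

lemma cbilinear_iff:
  "cbilinear f \<longleftrightarrow>
    (\<forall>x y z. f x (y + z) = f x y + f x z) \<and> (\<forall>x y z. f (x + y) z = f x z + f y z) \<and>
    (\<forall>a x y. f x (a *\<^sub>C y) = a *\<^sub>C f x y) \<and> (\<forall>a x y. f (a *\<^sub>C x) y = a *\<^sub>C f x y)"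
  unfolding cbilinear_def clinear_iff by blast

lemma scaleC_single: "z *\<^sub>C Poly_Mapping.single k w = Poly_Mapping.single k (z * w)"
  by (rule poly_mapping_eqI) (simp add: lookup_scaleC lookup_single when_def scaleC_complex_def)

lemma tmult_add_right: "x \<otimes>\<^sub>t (y + z) = x \<otimes>\<^sub>t y + x \<otimes>\<^sub>t z"
  \<comment> \<open>The relators are iterated differences, so after rebracketing the difference of
    the two sides is itself a generator of the span.\<close>
  by (transfer, unfold tensor_rel_def diff_diff_add[symmetric], rule cvs.span_base)
    (unfold tensor_relators_def, blast)

lemma tmult_add_left: "(x + y) \<otimes>\<^sub>t z = x \<otimes>\<^sub>t z + y \<otimes>\<^sub>t z"
  by (transfer, unfold tensor_rel_def diff_diff_add[symmetric], rule cvs.span_base)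
    (unfold tensor_relators_def, blast)

lemma tmult_scale_right: "x \<otimes>\<^sub>t (a *\<^sub>C y) = a *\<^sub>C (x \<otimes>\<^sub>t y)"
  by (transfer, unfold tensor_rel_def scaleC_single mult_1_right, rule cvs.span_base)
    (unfold tensor_relators_def, blast)

lemma tmult_scale_left: "(a *\<^sub>C x) \<otimes>\<^sub>t y = a *\<^sub>C (x \<otimes>\<^sub>t y)"
  by (transfer, unfold tensor_rel_def scaleC_single mult_1_right, rule cvs.span_base)
    (unfold tensor_relators_def, blast)

lemma tmult_zero_right [simp]: "x \<otimes>\<^sub>t 0 = 0"
  using tmult_add_right[of x 0 0] by simp

lemma tmult_zero_left [simp]: "0 \<otimes>\<^sub>t x = 0"
  using tmult_add_left[of 0 0 x] by simp

lemma tmult_minus_right: "x \<otimes>\<^sub>t (- y) = - (x \<otimes>\<^sub>t y)"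
  using tmult_add_right[of x y "- y"] by (simp add: eq_neg_iff_add_eq_0 add.commute)

lemma tmult_minus_left: "(- x) \<otimes>\<^sub>t y = - (x \<otimes>\<^sub>t y)"
  using tmult_add_left[of x "- x" y] by (simp add: eq_neg_iff_add_eq_0 add.commute)

lemma tmult_diff_right: "x \<otimes>\<^sub>t (y - z) = x \<otimes>\<^sub>t y - x \<otimes>\<^sub>t z"
  using tmult_add_right[of x y "- z"] by (simp add: tmult_minus_right)

lemma tmult_diff_left: "(x - y) \<otimes>\<^sub>t z = x \<otimes>\<^sub>t z - y \<otimes>\<^sub>t z"
  using tmult_add_left[of x "- y" z] by (simp add: tmult_minus_left)

lemmas tmult_simps = tmult_add_right tmult_add_left tmult_diff_right tmult_diff_left
  tmult_minus_right tmult_minus_left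

lemma clinear_add: "clinear f \<Longrightarrow> f (x + y) = f x + f y"
  and clinear_scale: "clinear f \<Longrightarrow> f (z *\<^sub>C x) = z *\<^sub>C f x"
  by (simp_all add: clinear_iff)

lemma clinear_zero: "clinear f \<Longrightarrow> f 0 = 0"
  using clinear_add[of f 0 0] by simp

lemma clinear_minus: "clinear f \<Longrightarrow> f (- x) = - f x"
  using clinear_add[of f x "- x"] by (simp add: clinear_zero eq_neg_iff_add_eq_0 add.commute)

lemma clinear_diff: "clinear f \<Longrightarrow> f (x - y) = f x - f y"
  using clinear_add[of f x "- y"] by (simp add: clinear_minus)

lemma clinear_sum: "clinear f \<Longrightarrow> f (sum g A) = (\<Sum>k\<in>A. f (g k))"
  by (induction A rule: infinite_finite_induct) (simp_all add: clinear_zero clinear_add)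

lemma scaleC_Pair: "z *\<^sub>C (a, b) = (z *\<^sub>C a, z *\<^sub>C b)"
  by (simp add: scaleC_prod_def)

text \<open>Updating at a fresh key is the same as adding a monomial. Stated with addition, the
  induction fits maps that are additive or bilinear.\<close>

lemma poly_mapping_single_induct [case_names zero single_add]:
  assumes "P 0" and "\<And>k v p. P p \<Longrightarrow> P (Poly_Mapping.single k v + p)"
  shows "P p"
proof (induction p rule: update_induct)
  case const
  show ?case by (rule assms)
next
  case (update f a b)
  have "Poly_Mapping.update a b f = Poly_Mapping.single a b + f"
    using update(1)
    by (intro poly_mapping_eqI) (auto simp: lookup_update lookup_add lookup_single in_keys_iff)
  with update assms(2) show ?case by simp
qed

text \<open>A formal representative is a finite sum of monomials, and the class of a monomial at
  \<open>(a, b)\<close> is a multiple of a pure tensor. The zero tensor needs no case of its own,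
  being the pure tensor of \<open>0\<close> and \<open>0\<close>.\<close>

lemma tensor_induct [case_names tmult add scale]:
  assumes "\<And>a b. P (a \<otimes>\<^sub>t b)" and "\<And>s t. P s \<Longrightarrow> P t \<Longrightarrow> P (s + t)"
    and "\<And>z t. P t \<Longrightarrow> P (z *\<^sub>C t)"
  shows "P t"
proof -
  have P0: "P 0"
    using assms(1)[of 0 0] by simp
  obtain p where t: "t = abs_tensor p"
    by (metis Quotient3_abs_rep[OF Quotient3_tensor])
  have "P (abs_tensor p)"
  proof (induction p rule: poly_mapping_single_induct)
    case zero
    show ?case using P0 by (simp add: zero_tensor_def)
  next
    case (single_add k v p)
    obtain a b where k: "k = (a, b)" by (cases k)
    have "abs_tensor (Poly_Mapping.single k v) = v *\<^sub>C (a \<otimes>\<^sub>t b)"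
      by (simp add: tmult.abs_eq scaleC_tensor.abs_eq scaleC_single k)
    with single_add show ?case
      using assms by (simp add: plus_tensor.abs_eq[symmetric])
  qed
  with t show ?thesis by simp
qed

lemma cbilinear_tmult_comp:
  assumes "clinear f" and "clinear g"
  shows "cbilinear (\<lambda>a b. f a \<otimes>\<^sub>t g b)"
  using assms unfolding cbilinear_iff
  by (simp add: clinear_add clinear_scale tmult_add_right tmult_add_left tmult_scale_right
      tmult_scale_left)

lemma tensor_map_tmult:
  assumes "clinear f" and "clinear g"
  shows "tensor_map f g (a \<otimes>\<^sub>t b) = f a \<otimes>\<^sub>t g b"
  unfolding tensor_map_def by (rule tensor_lift_tmult[OF cbilinear_tmult_comp[OF assms]])

lemma clinear_tensor_map:
  assumes "clinear f" and "clinear g"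
  shows "clinear (tensor_map f g)"
  unfolding tensor_map_def by (rule clinear_tensor_lift[OF cbilinear_tmult_comp[OF assms]])

lemma cbilinear_flip: "cbilinear (\<lambda>a b. b \<otimes>\<^sub>t a)"
  unfolding cbilinear_iff
  by (simp add: tmult_add_right tmult_add_left tmult_scale_right tmult_scale_left)

lemma tensor_flip_tmult: "tensor_flip (a \<otimes>\<^sub>t b) = b \<otimes>\<^sub>t a"
  unfolding tensor_flip_def by (rule tensor_lift_tmult[OF cbilinear_flip])

lemma clinear_tensor_flip: "clinear tensor_flip"
  unfolding tensor_flip_def by (rule clinear_tensor_lift[OF cbilinear_flip])

lemma cbilinear_diag:
  assumes "clinear f" and "clinear g"
  shows "cbilinear (\<lambda>a b. f a \<otimes>\<^sub>t b + a \<otimes>\<^sub>t g b)"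
  using assms unfolding cbilinear_iff
  by (simp add: clinear_add clinear_scale tmult_add_right tmult_add_left tmult_scale_right
      tmult_scale_left scaleC_add_right)

lemma diag_act_tmult:
  assumes "clinear f" and "clinear g"
  shows "diag_act f g (a \<otimes>\<^sub>t b) = f a \<otimes>\<^sub>t b + a \<otimes>\<^sub>t g b"
  unfolding diag_act_def by (rule tensor_lift_tmult[OF cbilinear_diag[OF assms]])

lemma clinear_diag_act:
  assumes "clinear f" and "clinear g"
  shows "clinear (diag_act f g)"
  unfolding diag_act_def by (rule clinear_tensor_lift[OF cbilinear_diag[OF assms]])

lemma clinear_ident: "clinear (\<lambda>x. x)"
  by (simp add: clinear_iff)

lemma clinear_Pair_zero: "clinear (\<lambda>x. (x, 0))" "clinear (\<lambda>x. (0, x))"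
  by (simp_all add: clinear_iff scaleC_Pair)

lemma tensor_map_tensor_map:
  assumes "clinear f" and "clinear g" and "clinear f'" and "clinear g'"
  shows "tensor_map f' g' (tensor_map f g t) = tensor_map (\<lambda>x. f' (f x)) (\<lambda>x. g' (g x)) t"
proof -
  have comp: "clinear (\<lambda>x. f' (f x))" "clinear (\<lambda>x. g' (g x))"
    using assms by (simp_all add: clinear_iff)
  show ?thesis
    by (induction t rule: tensor_induct)
      (simp_all add: tensor_map_tmult assms comp clinear_add[OF clinear_tensor_map]
        clinear_scale[OF clinear_tensor_map])
qed

section \<open>The enveloping algebra\<close>

lemma free_ring_simps [simp]:
  "carrier type_ring = UNIV" "mult type_ring = (*)" "one type_ring = 1"
  "zero type_ring = 0" "add type_ring = (+)"
  by (simp_all add: type_ring_def)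

lemma ring_type_ring: "ring (type_ring :: 'a::ring_1 ring)"
proof (rule ringI)
  show "abelian_group (type_ring :: 'a ring)"
  proof (rule abelian_groupI)
    fix x :: 'a
    show "\<exists>y\<in>carrier type_ring. y \<oplus>\<^bsub>type_ring\<^esub> x = \<zero>\<^bsub>type_ring\<^esub>"
      by (rule bexI[of _ "- x"]) simp_all
  qed (simp_all add: algebra_simps)
  show "monoid (type_ring :: 'a ring)"
    by (rule monoidI) (simp_all add: algebra_simps)
qed (simp_all add: algebra_simps)

text \<open>Negation is multiplication by \<open>- 1\<close>, so closure under it follows from
  absorption of products.\<close>

lemma type_ring_ideal_iff:
  fixes J :: "'a::ring_1 set"
  shows "ideal J type_ring \<longleftrightarrow>
    0 \<in> J \<and> (\<forall>x\<in>J. \<forall>y\<in>J. x + y \<in> J) \<and> (\<forall>x\<in>J. \<forall>a. a * x \<in> J \<and> x * a \<in> J)"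
proof
  assume "ideal J (type_ring :: 'a ring)"
  then interpret ideal J "type_ring :: 'a ring" .
  show "0 \<in> J \<and> (\<forall>x\<in>J. \<forall>y\<in>J. x + y \<in> J) \<and> (\<forall>x\<in>J. \<forall>a. a * x \<in> J \<and> x * a \<in> J)"
    using additive_subgroup.zero_closed[OF is_additive_subgroup]
      additive_subgroup.a_closed[OF is_additive_subgroup] I_l_closed I_r_closed
    by simp
next
  assume J: "0 \<in> J \<and> (\<forall>x\<in>J. \<forall>y\<in>J. x + y \<in> J) \<and> (\<forall>x\<in>J. \<forall>a. a * x \<in> J \<and> x * a \<in> J)"
  interpret ring "type_ring :: 'a ring" by (rule ring_type_ring)
  have "\<ominus>\<^bsub>type_ring\<^esub> x = - x" for x :: 'a
    by (rule minus_equality) simp_all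
  moreover have "- x \<in> J" if "x \<in> J" for x
    using J that by (metis mult_minus1)
  ultimately have "subgroup J (add_monoid type_ring)"
    using J by (intro subgroup.intro) (simp_all add: a_inv_def)
  then show "ideal J type_ring"
    using J by (intro idealI ring_type_ring) simp_all
qed

lemma uea_ideal_ideal: "ideal (uea_ideal br) free_ring"
  unfolding uea_ideal_def by (rule ring.genideal_ideal[OF ring_type_ring]) simp

lemma uea_relators_subset: "uea_relators br \<subseteq> uea_ideal br"
  unfolding uea_ideal_def by (rule ring.genideal_self[OF ring_type_ring]) simp

lemma uea_ideal_subset:
  assumes "ideal J free_ring" and "uea_relators br \<subseteq> J"
  shows "uea_ideal br \<subseteq> J"
  unfolding uea_ideal_def by (rule ring.genideal_minimal[OF ring_type_ring assms])

lemma uea_ideal_zero: "0 \<in> uea_ideal br"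
  and uea_ideal_add: "p \<in> uea_ideal br \<Longrightarrow> q \<in> uea_ideal br \<Longrightarrow> p + q \<in> uea_ideal br"
  and uea_ideal_mult_left: "p \<in> uea_ideal br \<Longrightarrow> a * p \<in> uea_ideal br"
  and uea_ideal_mult_right: "p \<in> uea_ideal br \<Longrightarrow> p * a \<in> uea_ideal br"
  using uea_ideal_ideal[of br] unfolding type_ring_ideal_iff by blast+

lemma uea_ideal_uminus: "p \<in> uea_ideal br \<Longrightarrow> - p \<in> uea_ideal br"
  using uea_ideal_mult_left[of p br "- 1"] by simp

lemma uea_class_eq: "uea_class br p = {a + p | a. a \<in> uea_ideal br}"
  by (auto simp: uea_class_def a_r_coset_def r_coset_def)

lemma uea_class_eq_iff: "uea_class br p = uea_class br q \<longleftrightarrow> p - q \<in> uea_ideal br"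
proof
  assume "uea_class br p = uea_class br q"
  moreover have "0 + p \<in> uea_class br p"
    unfolding uea_class_eq using uea_ideal_zero by blast
  ultimately show "p - q \<in> uea_ideal br"
    unfolding uea_class_eq by auto
next
  assume pq: "p - q \<in> uea_ideal br"
  have "a + p \<in> uea_class br q" if "a \<in> uea_ideal br" for a
    unfolding uea_class_eq
    using uea_ideal_add[OF that pq] by (intro CollectI exI[of _ "a + (p - q)"]) simp
  moreover have "a + q \<in> uea_class br p" if "a \<in> uea_ideal br" for a
    unfolding uea_class_eq
    using uea_ideal_add[OF that uea_ideal_uminus[OF pq]]
    by (intro CollectI exI[of _ "a + - (p - q)"]) simp
  ultimately show "uea_class br p = uea_class br q"
    by (auto simp: uea_class_eq)
qed

text \<open>These rules move all computation in the quotient to representatives in the free algebra.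
  Scalars act there through multiplication by constant polynomials.\<close>

lemma uea_simps:
  "carrier (uea br) = range (uea_class br)"
  "\<zero>\<^bsub>uea br\<^esub> = uea_class br 0"
  "\<one>\<^bsub>uea br\<^esub> = uea_class br 1"
  "uea_class br p \<oplus>\<^bsub>uea br\<^esub> uea_class br q = uea_class br (p + q)"
  "uea_class br p \<otimes>\<^bsub>uea br\<^esub> uea_class br q = uea_class br (p * q)"
  "z \<odot>\<^bsub>uea br\<^esub> uea_class br p = uea_class br (fconst z * p)"
proof -
  interpret I: ideal "uea_ideal br" free_ring by (rule uea_ideal_ideal)
  note defs = uea_def ring.extend_def module.fields_def ring.defs module.defs FactRing_def
    uea_class_def
  show "carrier (uea br) = range (uea_class br)"
    by (auto simp: defs A_RCOSETS_def RCOSETS_def a_r_coset_def)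
  show "\<zero>\<^bsub>uea br\<^esub> = uea_class br 0"
    using I.a_rcos_zero
    by (simp add: defs a_r_coset_def r_coset_def)
  show "\<one>\<^bsub>uea br\<^esub> = uea_class br 1"
    by (simp add: defs)
  show "uea_class br p \<oplus>\<^bsub>uea br\<^esub> uea_class br q = uea_class br (p + q)"
    using I.a_rcos_sum[of p q] by (simp add: defs)
  show "uea_class br p \<otimes>\<^bsub>uea br\<^esub> uea_class br q = uea_class br (p * q)"
    using I.rcoset_mult_add[of p q] by (simp add: defs)
  show "z \<odot>\<^bsub>uea br\<^esub> uea_class br p = uea_class br (fconst z * p)"
    using I.rcoset_mult_add[of "fconst z" p] by (simp add: defs)
qed

lemma uea_abelian_group: "abelian_group (uea br)"
proof (rule abelian_groupI)
  fix x assume "x \<in> carrier (uea br)"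
  then obtain p where "x = uea_class br p" by (auto simp: uea_simps)
  then show "\<exists>y\<in>carrier (uea br). y \<oplus>\<^bsub>uea br\<^esub> x = \<zero>\<^bsub>uea br\<^esub>"
    by (intro bexI[of _ "uea_class br (- p)"]) (simp_all add: uea_simps)
qed (auto simp: uea_simps algebra_simps)

lemma uea_mult_closed:
  "x \<in> carrier (uea br) \<Longrightarrow> y \<in> carrier (uea br) \<Longrightarrow> x \<otimes>\<^bsub>uea br\<^esub> y \<in> carrier (uea br)"
  by (auto simp: uea_simps)

text \<open>This makes the family of submodules intersected in \<open>uea_span\<close>
  nonempty.\<close>

lemma uea_carrier_submodule: "submodule (carrier (uea br)) (type_ring :: complex ring) (uea br)"
proof -
  interpret abelian_group "uea br" by (rule uea_abelian_group)
  show ?thesis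
    by (intro submodule.intro submodule_axioms.intro add.subgroup_self)
      (auto simp: uea_simps)
qed

lemma uea_span_superset: "S \<subseteq> uea_span br S"
  unfolding uea_span_def by blast

lemma uea_span_subgroup:
  assumes "S \<subseteq> carrier (uea br)"
  shows "subgroup (uea_span br S) (add_monoid (uea br))"
proof -
  interpret abelian_group "uea br" by (rule uea_abelian_group)
  show ?thesis
    unfolding uea_span_def
  proof (rule add.subgroups_Inter)
    show "{W. submodule W type_ring (uea br) \<and> S \<subseteq> W} \<noteq> {}"
      using uea_carrier_submodule assms by blast
  qed (auto simp: submodule_def)
qed

section \<open>Functoriality of the enveloping algebra\<close>

lemma free_map_superset:
  assumes "finite S" and "Poly_Mapping.keys p \<subseteq> S"
  shows "free_map f p = (\<Sum>w\<in>S. Poly_Mapping.single (map_fword f w) (Poly_Mapping.lookup p w))"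
  unfolding free_map_def
  by (rule sum.mono_neutral_left) (use assms in \<open>auto simp: in_keys_iff\<close>)

lemma free_map_single:
  "free_map f (Poly_Mapping.single w z) = Poly_Mapping.single (map_fword f w) z"
  by (simp add: free_map_def)

lemma free_map_add: "free_map f (p + q) = free_map f p + free_map f q"
proof -
  let ?S = "Poly_Mapping.keys p \<union> Poly_Mapping.keys q"
  have "free_map f (p + q)
      = (\<Sum>w\<in>?S. Poly_Mapping.single (map_fword f w) (Poly_Mapping.lookup (p + q) w))"
    by (rule free_map_superset) (use Poly_Mapping.keys_add[of p q] in auto)
  also have "\<dots> = free_map f p + free_map f q"
    by (simp add: free_map_superset[of ?S] lookup_add single_add sum.distrib)
  finally show ?thesis .
qed

lemma free_map_zero: "free_map f 0 = 0"
  by (simp add: free_map_def)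

lemma free_map_diff: "free_map f (p - q) = free_map f p - free_map f q"
  using free_map_add[of f "p - q" q] by simp

lemma map_fword_add: "map_fword f (u + v) = map_fword f u + map_fword f v"
  by (cases u; cases v) simp

text \<open>Additivity in each factor reduces this to two monomials, where it is compatibility with
  concatenation of words.\<close>

lemma free_map_mult: "free_map f (p * q) = free_map f p * free_map f q"
proof (induction p rule: poly_mapping_single_induct)
  case zero
  show ?case by (simp add: free_map_zero)
next
  case (single_add k v p)
  have "free_map f (Poly_Mapping.single k v * q)
      = free_map f (Poly_Mapping.single k v) * free_map f q"
  proof (induction q rule: poly_mapping_single_induct)
    case zero
    show ?case by (simp add: free_map_zero)
  next
    case (single_add l w q)
    then show ?case
      by (simp add: distrib_left mult_single free_map_add free_map_single map_fword_add)
  qed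
  with single_add show ?case
    by (simp add: distrib_right free_map_add)
qed

lemma free_map_fgen: "free_map f (fgen x) = fgen (f x)"
  by (simp add: fgen_def free_map_single)

lemma free_map_fconst: "free_map f (fconst z) = fconst z"
  by (simp add: fconst_def free_map_single zero_fword_def)

lemma free_map_one: "free_map f 1 = 1"
  using free_map_fconst[of f 1] by (simp add: fconst_def single_one)

text \<open>The preimage of the target ideal is an ideal, and a Lie morphism sends each relator to a
  relator; minimality of the generated ideal does the rest.\<close>

lemma free_map_uea_ideal:
  assumes "lie_hom br br' f" and "p \<in> uea_ideal br"
  shows "free_map f p \<in> uea_ideal br'"
proof -
  let ?J = "{p. free_map f p \<in> uea_ideal br'}"
  have "ideal ?J free_ring"
    unfolding type_ring_ideal_iff
    by (simp add: free_map_zero free_map_add free_map_mult uea_ideal_zero uea_ideal_add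
        uea_ideal_mult_left uea_ideal_mult_right)
  moreover have "uea_relators br \<subseteq> ?J"
  proof
    fix q assume "q \<in> uea_relators br"
    then have "free_map f q \<in> uea_relators br'"
      using assms(1) unfolding uea_relators_def lie_hom_def clinear_iff
      by (fastforce simp: free_map_diff free_map_mult free_map_fgen free_map_fconst)
    then show "q \<in> ?J"
      using uea_relators_subset by blast
  qed
  ultimately show ?thesis
    using uea_ideal_subset assms(2) by blast
qed

text \<open>\<open>uea_map\<close> takes the only element of an image set; the previous inclusion of
  ideals shows that all representatives of a class have the same image, so this set is a
  singleton.\<close>

lemma uea_map_class:
  assumes "lie_hom br br' f"
  shows "uea_map br' f (uea_class br p) = uea_class br' (free_map f p)"
proof -
  let ?F = "\<lambda>q. uea_class br' (free_map f q)"
  have const: "?F q = ?F p" if "q \<in> uea_class br p" for q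
  proof -
    obtain a where "a \<in> uea_ideal br" and "q = a + p"
      using \<open>q \<in> uea_class br p\<close> unfolding uea_class_eq by blast
    then show ?thesis
      using free_map_uea_ideal[OF assms] by (simp add: uea_class_eq_iff free_map_add)
  qed
  have "0 + p \<in> uea_class br p"
    unfolding uea_class_eq using uea_ideal_zero by blast
  with const have "?F ` uea_class br p = {?F p}"
    by (blast intro: image_eqI)
  then show ?thesis by (simp add: uea_map_def)
qed

section \<open>The tensor square inside the enveloping algebra of the double sum\<close>

lemma fconst_mult: "fconst z * p = z *\<^sub>C p"
proof (induction p rule: poly_mapping_single_induct)
  case (single_add k v p)
  then show ?case
    by (simp add: fconst_def distrib_left mult_single scaleC_add_right scaleC_single)
qed simp

text \<open>Constants are central because the empty word is neutral on both sides. This gives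
  homogeneity in the second tensor factor below.\<close>

lemma mult_fconst: "p * fconst z = z *\<^sub>C p"
proof (induction p rule: poly_mapping_single_induct)
  case (single_add k v p)
  then show ?case
    by (simp add: fconst_def distrib_right mult_single scaleC_add_right scaleC_single
        mult.commute[of v z])
qed simp

lemma axis_add: "axis k (x + y) = axis k x + (axis k y :: 'a::complex_vector ^ 'i)"
  and axis_scale: "axis k (z *\<^sub>C x) = z *\<^sub>C (axis k x :: 'a ^ 'i::finite)"
  by (simp_all add: vec_eq_iff axis_def scaleC_vec_def)

text \<open>The product of generators is bilinear only modulo the ideal, so
  \<open>eval_formal_cong\<close> does not apply. Instead each of the four kinds of tensor relators
  is shown to land in the ideal, using the relators that make \<open>fgen\<close> linear.\<close>

lemma tensor_rel_uea_ideal: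
  fixes br :: "'a::complex_vector \<Rightarrow> 'a \<Rightarrow> 'a"
  assumes "tensor_rel p q"
  shows "eval_formal (\<lambda>x y. fgen (axis 0 x) * fgen (axis 1 y)) p
    - eval_formal (\<lambda>x y. fgen (axis 0 x) * fgen (axis 1 y)) q
      \<in> uea_ideal (pow_bracket br :: 'a ^ 2 \<Rightarrow> _)"
proof -
  let ?I = "uea_ideal (pow_bracket br :: 'a ^ 2 \<Rightarrow> _)"
  let ?f = "\<lambda>x y :: 'a. fgen (axis 0 x :: 'a ^ 2) * fgen (axis 1 y)"
  interpret l: Vector_Spaces.linear scaleC scaleC "eval_formal ?f"
    by (rule clinear_eval_formal)
  have gen_add: "fgen (x + y) - fgen x - fgen y \<in> ?I" for x y
    using uea_relators_subset unfolding uea_relators_def by blast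
  have gen_scale: "fgen (z *\<^sub>C x) - z *\<^sub>C fgen x \<in> ?I" for x z
    using uea_relators_subset unfolding uea_relators_def fconst_mult[symmetric] by blast
  have "p - q \<in> cvs.span tensor_relators"
    using assms by (simp add: tensor_rel_def)
  then have "eval_formal ?f (p - q) \<in> ?I"
  proof (induction rule: cvs.span_induct_alt)
    case base
    show ?case by (simp add: l.zero uea_ideal_zero)
  next
    case (step z x y)
    have "eval_formal ?f x \<in> ?I"
    proof -
      have "?f (a + a') b - ?f a b - ?f a' b \<in> ?I" for a a' b
        using uea_ideal_mult_right[OF gen_add[of "axis 0 a" "axis 0 a'"], of "fgen (axis 1 b)"]
        by (simp add: axis_add algebra_simps)
      moreover have "?f a (b + b') - ?f a b - ?f a b' \<in> ?I" for a b b'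
        using uea_ideal_mult_left[OF gen_add[of "axis 1 b" "axis 1 b'"], of "fgen (axis 0 a)"]
        by (simp add: axis_add algebra_simps)
      moreover have "?f (w *\<^sub>C a) b - w *\<^sub>C ?f a b \<in> ?I" for w a b
        using uea_ideal_mult_right[OF gen_scale[of w "axis 0 a"], of "fgen (axis 1 b)"]
        by (simp add: axis_scale left_diff_distrib fconst_mult[symmetric] mult.assoc)
      moreover have "?f a (w *\<^sub>C b) - w *\<^sub>C ?f a b \<in> ?I" for w a b
        using uea_ideal_mult_left[OF gen_scale[of w "axis 1 b"], of "fgen (axis 0 a)"]
        by (simp add: axis_scale right_diff_distrib mult_fconst[symmetric] mult.assoc)
      ultimately show ?thesis
        using step(1)
        by (auto simp: tensor_relators_def l.diff eval_formal_single scaleC_one)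
    qed
    with step show ?case
      by (simp add: l.add l.scale fconst_mult[symmetric] uea_ideal_add uea_ideal_mult_left)
  qed
  then show ?thesis by (simp add: l.diff)
qed

lemma uea_tensor_abs:
  "uea_tensor br (abs_tensor p) =
    uea_class (pow_bracket br) (eval_formal (\<lambda>x y. fgen (axis 0 x) * fgen (axis 1 y)) p)"
  unfolding uea_tensor_def tensor_lift_def uea_class_eq_iff
  by (rule tensor_rel_uea_ideal[OF tensor_rel_rep])

lemma uea_tensor_tmult:
  "uea_tensor br (x \<otimes>\<^sub>t y) =
    uea_gen (pow_bracket br) (axis 0 x) \<otimes>\<^bsub>uea (pow_bracket br)\<^esub> uea_gen (pow_bracket br) (axis 1 y)"
  by (simp add: tmult.abs_eq uea_tensor_abs eval_formal_single scaleC_one uea_gen_def uea_simps)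

lemma uea_tensor_add:
  "uea_tensor br (s + t) = uea_tensor br s \<oplus>\<^bsub>uea (pow_bracket br)\<^esub> uea_tensor br t"
proof -
  obtain p q where "s = abs_tensor p" and "t = abs_tensor q"
    by (metis Quotient3_abs_rep[OF Quotient3_tensor])
  then show ?thesis
    by (simp add: plus_tensor.abs_eq uea_tensor_abs eval_formal_add uea_simps)
qed

lemma uea_tensor_carrier: "uea_tensor br t \<in> carrier (uea (pow_bracket br))"
  by (simp add: uea_tensor_def uea_simps)

lemma uea_tensor_minus: "uea_tensor br (- t) = \<ominus>\<^bsub>uea (pow_bracket br)\<^esub> uea_tensor br t"
proof (rule abelian_group.minus_equality[OF uea_abelian_group, symmetric])
  show "uea_tensor br (- t) \<oplus>\<^bsub>uea (pow_bracket br)\<^esub> uea_tensor br t = \<zero>\<^bsub>uea (pow_bracket br)\<^esub>"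
    using uea_tensor_add[of br "- t" t] uea_tensor_abs[of br 0]
    by (simp add: zero_tensor_def eval_formal_def uea_simps)
qed (simp_all add: uea_tensor_carrier)

lemma uea_tensor_diff:
  "uea_tensor br (s - t) = uea_tensor br s \<ominus>\<^bsub>uea (pow_bracket br)\<^esub> uea_tensor br t"
  using uea_tensor_add[of br s "- t"] by (simp add: uea_tensor_minus a_minus_def)


section \<open>The defining relations in degree two\<close>

lemma (in lie_algebra) br_zero: "br 0 x = 0" "br x 0 = 0"
  using bilinear by (simp_all add: cbilinear_def clinear_zero clinear_zero[of "\<lambda>x. br x _"])

lemma (in lie_module) act_zero: "act 0 x = 0" "act y 0 = 0"
  using act_bilinear by (simp_all add: cbilinear_def clinear_zero clinear_zero[of "\<lambda>x. act x _"])

context crossed_module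
begin

text \<open>This makes \<open>uea_map_class\<close> applicable to the map that defines
  \<open>U_n\<close>.\<close>

lemma lie_hom_incl_n:
  "lie_hom (pow_bracket brn) (pow_bracket bre) (\<lambda>X :: 'n ^ 'i::finite. \<chi> i. (0, X $ i))"
  unfolding lie_hom_def clinear_iff
  by (simp add: vec_eq_iff pow_bracket_def semidirect_def scaleC_vec_def scaleC_Pair
      act_zero M.br_zero)

lemma one_in_U_n: "\<one>\<^bsub>U_e\<^esub> \<in> (U_n :: (('m \<times> 'n) ^ 'i::finite) free_alg set set)"
proof -
  let ?j = "\<lambda>X :: 'n ^ 'i. \<chi> i. (0 :: 'm, X $ i)"
  have "uea_map (pow_bracket bre) ?j (uea_class (pow_bracket brn) 1) = \<one>\<^bsub>U_e\<^esub>"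
    by (simp add: uea_map_class[OF lie_hom_incl_n] free_map_one uea_simps)
  moreover have "uea_class (pow_bracket brn) 1 \<in> carrier (uea (pow_bracket brn :: 'n ^ 'i \<Rightarrow> _))"
    by (simp add: uea_simps)
  ultimately show ?thesis
    unfolding U_n_def by (metis image_eqI)
qed

lemma linear_mu: "clinear \<mu>"
  using mu_hom by (simp add: lie_hom_def)

text \<open>On the two summands of the semidirect product, \<open>\<beta>\<close> restricts to
  \<open>\<mu>\<close> and to the identity.\<close>

lemma beta_sum_Pair: "beta_sum (v, w) = tensor_map (\<lambda>X. X) \<mu> v + tensor_map \<mu> (\<lambda>X. X) w"
proof -
  have \<beta>: "clinear \<beta>"
    using linear_mu unfolding clinear_iff \<beta>_def
    by (simp add: split_def scaleC_prod_def scaleC_add_right)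
  show ?thesis
    by (simp add: beta_sum_def emb_def clinear_add[OF clinear_tensor_map[OF \<beta> \<beta>]]
        tensor_map_tensor_map clinear_Pair_zero \<beta>)
      (simp add: \<beta>_def clinear_zero[OF linear_mu])
qed

lemma cbilinear_m_dot: "cbilinear (\<lambda>s t. (s \<otimes>\<^sub>t act t u, act s u \<otimes>\<^sub>t t))"
  using act_bilinear unfolding cbilinear_iff
  by (simp add: scaleC_Pair tmult_add_left tmult_add_right tmult_scale_left tmult_scale_right)

section \<open>The quotient by the relations that move \<open>\<mu>\<close> from one factor to the
  other\<close>

lemma U_relations_generators_carrier:
  "{(x \<otimes>\<^bsub>U_e\<^esub> gen_mu u \<otimes>\<^bsub>U_e\<^esub> y \<otimes>\<^bsub>U_e\<^esub> gen_m v \<otimes>\<^bsub>U_e\<^esub> z)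
        \<ominus>\<^bsub>U_e\<^esub> (x \<otimes>\<^bsub>U_e\<^esub> gen_m u \<otimes>\<^bsub>U_e\<^esub> y \<otimes>\<^bsub>U_e\<^esub> gen_mu v \<otimes>\<^bsub>U_e\<^esub> z)
      | x u y v z. x \<in> U_n \<and> y \<in> U_n \<and> z \<in> U_n}
    \<subseteq> carrier (U_e :: (complex, (('m \<times> 'n) ^ 'i::finite) free_alg set) module)"
proof -
  have "U_n \<subseteq> carrier (U_e :: (complex, (('m \<times> 'n) ^ 'i) free_alg set) module)"
    unfolding U_n_def by (auto simp: uea_simps uea_map_class[OF lie_hom_incl_n])
  moreover have "gen_mu u \<in> carrier U_e" "gen_m u \<in> carrier U_e" for u :: "'m ^ 'i"
    by (simp_all add: gen_mu_def gen_m_def uea_gen_def uea_simps)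
  ultimately show ?thesis
    by (auto intro!: uea_mult_closed abelian_group.minus_closed[OF uea_abelian_group])
qed

lemma U_relations_subgroup:
  "subgroup U_relations
    (add_monoid (U_e :: (complex, (('m \<times> 'n) ^ 'i::finite) free_alg set) module))"
  unfolding U_relations_def by (rule uea_span_subgroup[OF U_relations_generators_carrier])

lemma U_proj_eq:
  fixes p q :: "(('m \<times> 'n) ^ 'i::finite) free_alg set"
  assumes "q \<in> U_relations" and "p \<in> carrier U_e"
  shows "U_proj (q \<oplus>\<^bsub>U_e\<^esub> p) = U_proj p"
proof -
  interpret abelian_group "U_e :: (complex, (('m \<times> 'n) ^ 'i) free_alg set) module"
    by (rule uea_abelian_group)
  have "q \<in> carrier U_e"
    using subgroup.subset[OF U_relations_subgroup] assms(1) by auto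
  then have "(U_relations :: (('m \<times> 'n) ^ 'i) free_alg set set) #>\<^bsub>add_monoid U_e\<^esub> (q \<oplus>\<^bsub>U_e\<^esub> p)
      = U_relations #>\<^bsub>add_monoid U_e\<^esub> p"
    using assms
      add.coset_mult_assoc[OF subgroup.subset[OF U_relations_subgroup, simplified], of q p]
      add.coset_join2[OF _ U_relations_subgroup, of q]
    by simp
  \<comment> \<open>Replacing the carrier by \<open>A_space\<close> leaves the addition as it is, so
    the coset is the one formed in the additive group of \<open>U_e\<close>.\<close>
  then show ?thesis
    by (simp add: U_proj_def a_r_coset_def r_coset_def)
qed

lemma axis_cross:
  "(\<chi> i. (axis k u $ i, 0)) = axis k (u, 0)"
  "(\<chi> i. (0, \<mu> (axis k u $ i))) = axis k (0, \<mu> u)"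
  by (simp_all add: vec_eq_iff axis_def clinear_zero[OF linear_mu] zero_prod_def)

text \<open>This is the defining relation with \<open>x = y = z = 1\<close>, with \<open>u\<close>
  placed in the first copy and \<open>v\<close> in the second.\<close>

lemma uea_tensor_relation:
  "uea_tensor bre ((0, \<mu> u) \<otimes>\<^sub>t (v, 0) - (u, 0) \<otimes>\<^sub>t (0, \<mu> v)) \<in> U_relations"
proof -
  have "(\<one>\<^bsub>U_e\<^esub> \<otimes>\<^bsub>U_e\<^esub> gen_mu (axis 0 u) \<otimes>\<^bsub>U_e\<^esub> \<one>\<^bsub>U_e\<^esub> \<otimes>\<^bsub>U_e\<^esub> gen_m (axis 1 v) \<otimes>\<^bsub>U_e\<^esub> \<one>\<^bsub>U_e\<^esub>)
      \<ominus>\<^bsub>U_e\<^esub> (\<one>\<^bsub>U_e\<^esub> \<otimes>\<^bsub>U_e\<^esub> gen_m (axis 0 u) \<otimes>\<^bsub>U_e\<^esub> \<one>\<^bsub>U_e\<^esub> \<otimes>\<^bsub>U_e\<^esub> gen_mu (axis 1 v) \<otimes>\<^bsub>U_e\<^esub> \<one>\<^bsub>U_e\<^esub>)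
      \<in> (U_relations :: (('m \<times> 'n) ^ 2) free_alg set set)"
    unfolding U_relations_def
    by (rule subsetD[OF uea_span_superset]) (use one_in_U_n in blast)
  then show ?thesis
    by (simp add: uea_tensor_diff uea_tensor_tmult gen_mu_def gen_m_def axis_cross
        uea_gen_def uea_simps)
qed

lemma emb_add: "emb (v + w) = emb v + emb w"
  by (cases v; cases w)
    (simp add: emb_def clinear_add[OF clinear_tensor_map] clinear_Pair_zero algebra_simps)

lemma emb_tmult: "emb (X \<otimes>\<^sub>t v, u \<otimes>\<^sub>t Y) = (0, X) \<otimes>\<^sub>t (v, 0) + (u, 0) \<otimes>\<^sub>t (0, Y)"
  by (simp add: emb_def tensor_map_tmult clinear_Pair_zero)

text \<open>The arbitrary remainder \<open>w\<close> lets relations be peeled off a sum one at a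
  time.\<close>

lemma to_U2_relation: "to_U2 ((\<mu> u \<otimes>\<^sub>t v, - (u \<otimes>\<^sub>t \<mu> v)) + w) = to_U2 w"
proof -
  have "emb (\<mu> u \<otimes>\<^sub>t v, - (u \<otimes>\<^sub>t \<mu> v)) = (0, \<mu> u) \<otimes>\<^sub>t (v, 0) - (u, 0) \<otimes>\<^sub>t (0, \<mu> v)"
    \<comment> \<open>The sign is absorbed into the left factor because \<open>emb_tmult\<close>
      expects a pure tensor.\<close>
    using emb_tmult[of "\<mu> u" v "- u" "\<mu> v"] tmult_minus_left[of "(u, 0 :: 'n)" "(0 :: 'm, \<mu> v)"]
    by (simp add: tmult_minus_left)
  then show ?thesis
    using U_proj_eq[OF uea_tensor_relation uea_tensor_carrier]
    by (simp add: to_U2_def emb_add uea_tensor_add)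
qed

lemma to_U2_sum_relation:
  "to_U2 ((\<Sum>k\<in>A. (\<mu> (u k) \<otimes>\<^sub>t v k, - (u k \<otimes>\<^sub>t \<mu> (v k)))) + w) = to_U2 w"
proof (induction A arbitrary: w rule: infinite_finite_induct)
  case (insert k A)
  then show ?case
    by (simp add: add.assoc to_U2_relation)
qed simp_all

end

section \<open>The quasi-invariant tensor of an abelian extension\<close>

text \<open>Polarization: expand \<open>f\<close> at \<open>x + y\<close> in both arguments.\<close>

lemma alternating_swap:
  assumes "cbilinear f" and "\<And>x. f x x = 0"
  shows "f x y = - f y x"
proof -
  have "f (x + y) (x + y) = f x x + f x y + (f y x + f y y)"
    using assms(1) unfolding cbilinear_iff by (simp add: algebra_simps)
  then show ?thesis
    by (simp add: assms(2) eq_neg_iff_add_eq_0)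
qed

text \<open>In the Jacobi sum the terms with \<open>\<alpha>\<close> add up to its coboundary, the
  terms in \<open>h\<close> cancel by the module axiom, and the second component is the Jacobi
  identity of \<open>br\<close>.\<close>

lemma lie_algebra_abelian_ext:
  assumes "lie_module br act" and "ce_cocycle2 br act \<alpha>"
  shows "lie_algebra (abelian_ext br act \<alpha>)"
proof -
  interpret lie_module br act by fact
  have \<alpha>: "cbilinear \<alpha>" and \<alpha>_alt: "\<alpha> x x = 0" and \<alpha>_d: "ce_d2 br act \<alpha> x y z = 0" for x y z
    using assms(2) by (simp_all add: ce_cocycle2_def)
  note simps = \<alpha>[unfolded cbilinear_iff, rule_format] bilinear[unfolded cbilinear_iff, rule_format]
    act_bilinear[unfolded cbilinear_iff, rule_format]
  have act_diff: "act x (v - w) = act x v - act x w" for x v w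
    using act_bilinear by (simp add: cbilinear_def clinear_diff)
  have act_minus: "act x (- v) = - act x v" for x v
    using act_bilinear by (simp add: cbilinear_def clinear_minus)
  have \<alpha>_minus: "\<alpha> (- x) y = - \<alpha> x y" for x y
    using clinear_minus[of "\<lambda>x. \<alpha> x y" x] \<alpha> by (simp add: cbilinear_def)
  note br_swap = alternating_swap[OF bilinear alternating]
  note \<alpha>_swap = alternating_swap[OF \<alpha> \<alpha>_alt]
  show ?thesis
  proof
    show "cbilinear (abelian_ext br act \<alpha>)"
      unfolding cbilinear_iff abelian_ext_def
      by (auto simp: split_def scaleC_prod_def simps cvs.scale_right_diff_distrib
          scaleC_add_right)
    show "abelian_ext br act \<alpha> x x = 0" for x
      by (simp add: abelian_ext_def split_def alternating \<alpha>_alt zero_prod_def)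
    show "abelian_ext br act \<alpha> x (abelian_ext br act \<alpha> y z)
        + abelian_ext br act \<alpha> y (abelian_ext br act \<alpha> z x)
        + abelian_ext br act \<alpha> z (abelian_ext br act \<alpha> x y) = 0" for x y z
    proof -
      obtain h1 X h2 Y h3 Z where e: "x = (h1, X)" "y = (h2, Y)" "z = (h3, Z)"
        by (cases x; cases y; cases z)
      \<comment> \<open>The coboundary is brought into the cyclic form in which the Jacobi sum
        produces it.\<close>
      have "act X (\<alpha> Y Z) + act Y (\<alpha> Z X) + act Z (\<alpha> X Y)
          + \<alpha> X (br Y Z) + \<alpha> Y (br Z X) + \<alpha> Z (br X Y) = ce_d2 br act \<alpha> X Y Z"
        using br_swap[of Z X] \<alpha>_swap[of X "br Y Z"] \<alpha>_swap[of Y "br Z X"] \<alpha>_swap[of Z "br X Y"]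
          \<alpha>_swap[of Z X]
        by (simp add: ce_d2_def act_minus \<alpha>_minus)
      then show ?thesis
        using jacobi[of X Y Z] \<alpha>_d[of X Y Z]
        by (simp add: e abelian_ext_def zero_prod_def simps(1) act_diff act_bracket simps
            algebra_simps)
    qed
  qed
qed

text \<open>Since \<open>(d v, 0)\<close> has no component in the quotient algebra, it acts by zero
  on the abelian algebra \<open>V2\<close>, and its bracket with \<open>X\<close> is
  \<open>d v\<close> acted on by \<open>snd X\<close>. The axioms thus come down to \<open>d\<close>
  being a module map.\<close>

lemma crossed_module_abelian_ext:
  assumes "lie_module br act2" and "lie_module br act3" and "lie_module_hom act2 act3 d"
    and "ce_cocycle2 br act3 \<alpha>"
  shows "crossed_module (\<lambda>_ _. 0) (abelian_ext br act3 \<alpha>) (\<lambda>e v. act2 (snd e) v) (\<lambda>v. (d v, 0))"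
proof -
  interpret V2: lie_module br act2 by fact
  interpret V3: lie_module br act3 by fact
  interpret E: lie_algebra "abelian_ext br act3 \<alpha>"
    by (rule lie_algebra_abelian_ext) fact+
  have d: "clinear d" and d_act: "d (act2 x v) = act3 x (d v)" for x v
    using assms(3) by (simp_all add: lie_module_hom_def)
  have "cbilinear \<alpha>"
    using assms(4) by (simp add: ce_cocycle2_def)
  then have \<alpha>_zero: "\<alpha> x 0 = 0" "\<alpha> 0 x = 0" for x
    using clinear_zero[of "\<alpha> x"] clinear_zero[of "\<lambda>y. \<alpha> y x"] by (simp_all add: cbilinear_def)
  show ?thesis
  proof unfold_locales
    show "cbilinear (\<lambda>e. act2 (snd e))"
      using V2.act_bilinear by (simp add: cbilinear_iff scaleC_prod_def)
    show "act2 (snd (abelian_ext br act3 \<alpha> x y)) v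
        = act2 (snd x) (act2 (snd y) v) - act2 (snd y) (act2 (snd x) v)" for x y v
      by (simp add: abelian_ext_def split_def V2.act_bracket)
    show "lie_hom (\<lambda>_ _. 0) (abelian_ext br act3 \<alpha>) (\<lambda>v. (d v, 0))"
      using d by (simp add: lie_hom_def clinear_iff abelian_ext_def scaleC_prod_def \<alpha>_zero
          clinear_zero[OF d] V3.act_zero V2.br_zero zero_prod_def)
    show "(d (act2 (snd X) u), 0) = abelian_ext br act3 \<alpha> X (d u, 0)" for X u
      by (simp add: abelian_ext_def split_def d_act \<alpha>_zero V3.act_zero V2.br_zero)
  qed (simp_all add: cbilinear_iff V2.act_zero)
qed

theorem theorem1:
  fixes br :: "'g::complex_vector \<Rightarrow> 'g \<Rightarrow> 'g"
    and act2 :: "'g \<Rightarrow> 'v2::complex_vector \<Rightarrow> 'v2"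
    and act3 :: "'g \<Rightarrow> 'v3::complex_vector \<Rightarrow> 'v3"
    and i :: "complex \<Rightarrow> 'v2" and d :: "'v2 \<Rightarrow> 'v3"
    and \<alpha> :: "'g \<Rightarrow> 'g \<Rightarrow> 'v3" and Q :: "'v3 \<Rightarrow> 'v2"
    and \<omega> :: "'g \<Rightarrow> 'g \<Rightarrow> 'v2" and \<Phi> :: "'g \<Rightarrow> 'g \<Rightarrow> 'g \<Rightarrow> 'v2"
    and \<mu> :: "'v2 \<Rightarrow> 'v3 \<times> 'g" and one2 c :: 'v2
    and n :: nat and s t :: "nat \<Rightarrow> 'g"
    and r :: "'g \<otimes>\<^sub>V 'g" and rbar :: "('v3 \<times> 'g) \<otimes>\<^sub>V ('v3 \<times> 'g)"
    and \<xi> \<xi>\<^sub>0 C :: "'v3 \<times> 'g \<Rightarrow> (('v3 \<times> 'g) \<otimes>\<^sub>V 'v2) \<times> ('v2 \<otimes>\<^sub>V ('v3 \<times> 'g))"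
  assumes "lie_algebra br"
    and "lie_module br act2" and "lie_module br act3"
    and "lie_module_hom (\<lambda>_ _. 0) act2 i" and "lie_module_hom act2 act3 d"
    and "inj i" and "range i = {v. d v = 0}" and "surj d"
    and "ce_cocycle2 br act3 \<alpha>"
    and "\<mu> = (\<lambda>v. (d v, 0))"
    and "one2 = i 1"
    and "clinear Q" and "\<And>h. d (Q h) = h"
    and "\<omega> = (\<lambda>X Y. Q (\<alpha> X Y))"
    and "\<Phi> = ce_d2 br act2 \<omega>"
    and "r = (\<Sum>k<n. s k \<otimes>\<^sub>t t k)"
    and "tensor_flip r = r"
    and "\<And>X. diag_act (br X) (br X) r = 0"
    and "\<And>X Y. (\<Sum>k<n. \<Phi> (s k) X Y \<otimes>\<^sub>t t k) = one2 \<otimes>\<^sub>t br X Y"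
    and "\<And>X Y. (\<Sum>k<n. s k \<otimes>\<^sub>t \<Phi> (t k) X Y) = br X Y \<otimes>\<^sub>t one2"
    and "rbar = (\<Sum>k<n. (0, s k) \<otimes>\<^sub>t (0, t k))"
    and "\<mu> c = 0"
    and "clinear \<xi>\<^sub>0"
    and "\<And>X. \<xi>\<^sub>0 (0, X) =
           (\<Sum>k<n. ((0, s k) \<otimes>\<^sub>t \<omega> (t k) X, \<omega> (s k) X \<otimes>\<^sub>t (0, t k)))"
    and "\<And>h. \<xi>\<^sub>0 (h, 0) =
           (\<Sum>k<n. ((0, s k) \<otimes>\<^sub>t act2 (t k) (Q h), act2 (s k) (Q h) \<otimes>\<^sub>t (0, t k)))"
    and "clinear C"
    and "\<And>h X. C (h, X) = ((0, X) \<otimes>\<^sub>t one2, one2 \<otimes>\<^sub>t (0, X))"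
    and "\<xi> = (\<lambda>e. - \<xi>\<^sub>0 e - C e)"
  shows "quasi_invariant_tensor (\<lambda>_ _. 0) (abelian_ext br act3 \<alpha>)
           (\<lambda>e v. act2 (snd e) v) \<mu> rbar \<xi> c"
proof -
  let ?b = "abelian_ext br act3 \<alpha>"
  let ?a = "\<lambda>(e :: 'v3 \<times> 'g) v. act2 (snd e) v"
  interpret V2: lie_module br act2 by fact
  interpret V3: lie_module br act3 by fact
  interpret X: crossed_module "\<lambda>_ _. 0" ?b ?a \<mu>
    unfolding assms(10) by (rule crossed_module_abelian_ext) fact+
  define j :: "'g \<Rightarrow> 'v3 \<times> 'g" where "j X = (0, X)" for X
  define \<theta> where "\<theta> e w = \<omega> w (snd e) + act2 w (Q (fst e))" for e w
  have Pair_sum: "(\<Sum>k\<in>K. (f k, g k)) = (sum f K, sum g K)"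
    for f :: "nat \<Rightarrow> 'x::comm_monoid_add" and g :: "nat \<Rightarrow> 'y::comm_monoid_add" and K
    by (induction K rule: infinite_finite_induct) (simp_all add: zero_prod_def)

  have j: "clinear j"
    unfolding j_def by (rule clinear_Pair_zero)
  have d: "clinear d" and d_act: "d (act2 x v) = act3 x (d v)" for x v
    using assms(5) by (simp_all add: lie_module_hom_def)
  have i: "act2 x (i z) = 0" for x z
  proof -
    \<comment> \<open>The complex numbers carry the zero action, so equivariance of \<open>i\<close>
      identifies \<open>act2 x (i z)\<close> with the image of \<open>0\<close>.\<close>
    have "clinear i" and "i 0 = act2 x (i z)"
      using assms(4) unfolding lie_module_hom_def by blast+
    then show ?thesis by (metis clinear_zero)
  qed
  have act_ker: "act2 x v = 0" if "d v = 0" for x v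
  proof -
    have "v \<in> range i"
      unfolding assms(7) using that by simp
    then obtain z where "v = i z"
      by (rule rangeE)
    then show ?thesis by (simp add: i)
  qed
  have act2: "clinear (act2 x)" "clinear (\<lambda>x. act2 x v)" for x v
    using V2.act_bilinear by (simp_all add: cbilinear_def)
  \<comment> \<open>By exactness, the action on \<open>V2\<close> depends only on the image under
    \<open>d\<close>. Hence \<open>Q\<close>, although not assumed equivariant, can be replaced by
    any other lift under the action.\<close>
  have act_section: "act2 x v = act2 x w" if "d v = d w" for x v w
    using act_ker[of "v - w" x] that by (simp add: clinear_diff[OF d] clinear_diff[OF act2(1)])
  have act_one: "act2 x one2 = 0" for x
    using i by (simp add: assms(11))
  have \<mu>: "\<mu> v = (d v, 0)" for v
    by (simp add: assms(10))
  have "one2 \<in> range i"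
    unfolding assms(11) by (rule rangeI)
  then have d_one: "d one2 = 0"
    unfolding assms(7) by simp
  then have \<mu>_one: "\<mu> one2 = 0"
    by (simp add: \<mu> zero_prod_def)

  have \<alpha>: "cbilinear \<alpha>" and \<alpha>_alt: "\<alpha> x x = 0" for x
    using assms(9) by (simp_all add: ce_cocycle2_def)
  have \<omega>: "cbilinear \<omega>"
    using \<alpha>
    by (simp add: assms(14) cbilinear_iff clinear_add[OF assms(12)] clinear_scale[OF assms(12)])
  have \<omega>_swap: "\<omega> x y = - \<omega> y x" for x y
    by (rule alternating_swap[OF \<omega>]) (simp add: assms(14) \<alpha>_alt clinear_zero[OF assms(12)])
  have \<alpha>_swap: "\<alpha> x y = - \<alpha> y x" for x y
    by (rule alternating_swap[OF \<alpha> \<alpha>_alt])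
  have \<omega>_minus: "\<omega> (- x) y = - \<omega> x y" for x y
    using clinear_minus[of "\<lambda>x. \<omega> x y"] \<omega> by (simp add: cbilinear_def)
  note br_swap = alternating_swap[OF V2.bilinear V2.alternating]
  have d_\<omega>: "d (\<omega> x y) = \<alpha> x y" for x y
    by (simp add: assms(14) assms(13))

  have \<theta>: "clinear (\<theta> e)" for e
    using \<omega> V2.act_bilinear unfolding \<theta>_def cbilinear_iff clinear_iff
    by (simp add: scaleC_add_right)
  \<comment> \<open>The minus sign comes from
    \<open>\<alpha> (snd e) w = - \<alpha> w (snd e)\<close> and from the term
    \<open>- act3 w (fst e)\<close> of the bracket.\<close>
  have bracket_j: "?b e (j w) = j (br (snd e) w) - \<mu> (\<theta> e w)" for e w
    by (simp add: abelian_ext_def split_def j_def \<mu> \<theta>_def clinear_add[OF d] d_act d_\<omega>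
        assms(13) \<alpha>_swap[of w "snd e"] V3.act_zero)

  have \<xi>: "\<xi> e = (- (\<Sum>k<n. j (s k) \<otimes>\<^sub>t \<theta> e (t k)) - j (snd e) \<otimes>\<^sub>t one2,
                 - (\<Sum>k<n. \<theta> e (s k) \<otimes>\<^sub>t j (t k)) - one2 \<otimes>\<^sub>t j (snd e))" for e
  proof -
    have "\<xi>\<^sub>0 e = \<xi>\<^sub>0 (0, snd e) + \<xi>\<^sub>0 (fst e, 0)"
      using clinear_add[OF assms(23), of "(0, snd e)" "(fst e, 0)"] by simp
    moreover have "C e = (j (snd e) \<otimes>\<^sub>t one2, one2 \<otimes>\<^sub>t j (snd e))"
      using assms(27)[of "fst e" "snd e"] by (simp add: j_def)
    ultimately show ?thesis
      by (simp add: assms(28) assms(24) assms(25) Pair_sum \<theta>_def j_def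
          tmult_add_left tmult_add_right sum.distrib)
  qed

  have rbar: "rbar = (\<Sum>k<n. j (s k) \<otimes>\<^sub>t j (t k))"
    by (simp add: assms(21) j_def)
  \<comment> \<open>The families \<open>s\<close> and \<open>t\<close> need not be exchangeable term
    by term; only the tensor \<open>r\<close> is symmetric. Applying the tensor product of
    \<open>f\<close> and \<open>g\<close> to its symmetry gives a rule for sums.\<close>
  have flip: "(\<Sum>k<n. f (t k) \<otimes>\<^sub>t g (s k)) = (\<Sum>k<n. f (s k) \<otimes>\<^sub>t g (t k))"
    if "clinear f" "clinear g" for f :: "'g \<Rightarrow> 'x::complex_vector" and g :: "'g \<Rightarrow> 'y::complex_vector"
  proof -
    have "tensor_map f g (tensor_flip r) = (\<Sum>k<n. f (t k) \<otimes>\<^sub>t g (s k))"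
      by (simp add: assms(16) clinear_sum[OF clinear_tensor_flip] tensor_flip_tmult
          clinear_sum[OF clinear_tensor_map[OF that]] tensor_map_tmult[OF that])
    moreover have "tensor_map f g r = (\<Sum>k<n. f (s k) \<otimes>\<^sub>t g (t k))"
      by (simp add: assms(16) clinear_sum[OF clinear_tensor_map[OF that]] tensor_map_tmult[OF that])
    ultimately show ?thesis
      using assms(17) by simp
  qed
  have br: "clinear (br x)" for x
    using V2.bilinear by (simp add: cbilinear_def)
  \<comment> \<open>In the same way, invariance of \<open>r\<close> becomes a rule that moves
    \<open>br x\<close> to the other factor at the cost of a sign.\<close>
  have invariant: "(\<Sum>k<n. f (br x (s k)) \<otimes>\<^sub>t g (t k)) = - (\<Sum>k<n. f (s k) \<otimes>\<^sub>t g (br x (t k)))"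
    if "clinear f" "clinear g"
    for f :: "'g \<Rightarrow> 'x::complex_vector" and g :: "'g \<Rightarrow> 'y::complex_vector" and x
  proof -
    have "tensor_map f g (diag_act (br x) (br x) r)
        = (\<Sum>k<n. f (br x (s k)) \<otimes>\<^sub>t g (t k) + f (s k) \<otimes>\<^sub>t g (br x (t k)))"
      by (simp add: assms(16) clinear_sum[OF clinear_diag_act[OF br br]] diag_act_tmult[OF br br]
          clinear_sum[OF clinear_tensor_map[OF that]] clinear_add[OF clinear_tensor_map[OF that]]
          tensor_map_tmult[OF that])
    then show ?thesis
      using assms(18)
      by (simp add: clinear_zero[OF clinear_tensor_map[OF that]] sum.distrib eq_neg_iff_add_eq_0)
  qed

  have \<Phi>_right: "(\<Sum>k<n. j (s k) \<otimes>\<^sub>t \<Phi> (t k) x y) = j (br x y) \<otimes>\<^sub>t one2" for x y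
    using assms(20)[of x y, THEN arg_cong[where f = "tensor_map j (\<lambda>v. v)"]]
    by (simp add: clinear_sum[OF clinear_tensor_map[OF j clinear_ident]]
        tensor_map_tmult[OF j clinear_ident])
  have \<Phi>_left: "(\<Sum>k<n. \<Phi> (s k) x y \<otimes>\<^sub>t j (t k)) = one2 \<otimes>\<^sub>t j (br x y)" for x y
    using assms(19)[of x y, THEN arg_cong[where f = "tensor_map (\<lambda>v. v) j"]]
    by (simp add: clinear_sum[OF clinear_tensor_map[OF clinear_ident j]]
        tensor_map_tmult[OF clinear_ident j])

  have b: "clinear (?b e)" for e
    using X.bilinear unfolding cbilinear_def by blast
  have \<mu>_linear: "clinear \<mu>"
    by (rule X.linear_mu)

  show ?thesis
  proof (intro quasi_invariant_tensor.intro quasi_invariant_tensor_axioms.intro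
      X.crossed_module_axioms)
    show "tensor_flip rbar = rbar"
      unfolding rbar
      by (simp add: clinear_sum[OF clinear_tensor_flip] tensor_flip_tmult flip[OF j j])
    show "clinear \<xi>"
      using assms(23) assms(26)
      by (simp add: assms(28) clinear_iff cvs.scale_right_diff_distrib)
    show "X.flip_sum (\<xi> e) = \<xi> e" for e
      by (simp add: \<xi> X.flip_sum_def clinear_diff[OF clinear_tensor_flip]
          clinear_minus[OF clinear_tensor_flip] clinear_sum[OF clinear_tensor_flip]
          tensor_flip_tmult flip[OF j \<theta>] flip[OF \<theta> j])
    show "act2 (snd e) c = 0" for e
      using assms(22) by (intro act_ker) (simp add: \<mu> zero_prod_def)
    show "\<mu> c = 0" by fact
    show "diag_act (?b e) (?b e) rbar = X.beta_sum (\<xi> e)" for e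
    proof -
      have "diag_act (?b e) (?b e) rbar = (\<Sum>k<n. ?b e (j (s k)) \<otimes>\<^sub>t j (t k))
          + (\<Sum>k<n. j (s k) \<otimes>\<^sub>t ?b e (j (t k)))"
        by (simp add: rbar clinear_sum[OF clinear_diag_act[OF b b]] diag_act_tmult[OF b b]
            sum.distrib)
      \<comment> \<open>The parts with \<open>j (br (snd e) _)\<close> cancel by invariance, leaving
        the corrections from \<open>bracket_j\<close>.\<close>
      also have "\<dots> = - (\<Sum>k<n. \<mu> (\<theta> e (s k)) \<otimes>\<^sub>t j (t k)) - (\<Sum>k<n. j (s k) \<otimes>\<^sub>t \<mu> (\<theta> e (t k)))"
        by (simp add: bracket_j tmult_diff_left tmult_diff_right sum_subtractf invariant[OF j j])
      also have "\<dots> = X.beta_sum (\<xi> e)"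
        by (simp add: \<xi> X.beta_sum_Pair clinear_diff[OF clinear_tensor_map]
            clinear_minus[OF clinear_tensor_map] clinear_sum[OF clinear_tensor_map]
            tensor_map_tmult clinear_ident \<mu>_linear \<mu>_one)
      finally show ?thesis .
    qed
    show "X.to_U2 (X.m_dot u rbar) = X.to_U2 (\<xi> (\<mu> u))" for u
    proof -
      have "X.m_dot u rbar = - (\<Sum>k<n. (j (s k) \<otimes>\<^sub>t act2 (t k) u, act2 (s k) u \<otimes>\<^sub>t j (t k)))"
        by (simp add: X.m_dot_def rbar clinear_sum[OF clinear_tensor_lift[OF X.cbilinear_m_dot]]
            tensor_lift_tmult[OF X.cbilinear_m_dot] j_def)
      \<comment> \<open>Here \<open>Q (d u)\<close> and \<open>u\<close> are lifts of the same
        element. Since \<open>snd (\<mu> u)\<close> is zero, \<open>C\<close> contributes nothing,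
        and (b) already holds before passing to the quotient.\<close>
      moreover have "\<theta> (\<mu> u) w = act2 w u" for w
        using \<omega> by (simp add: \<theta>_def \<mu> cbilinear_def clinear_zero[of "\<omega> w"] assms(13)
            act_section[of "Q (d u)" u])
      ultimately show ?thesis
        by (simp add: \<xi> Pair_sum \<mu> clinear_zero[OF j])
    qed
    show "X.to_U2 (\<xi> (?b e e')) = X.to_U2 (X.act_sum e (\<xi> e') - X.act_sum e' (\<xi> e))" for e e'
    proof -
      \<comment> \<open>\<open>G\<close> and \<open>G'\<close> collect the corrections by
        \<open>\<mu>\<close> in the two summands, arranged so that \<open>G e e'\<close> and
        \<open>- G' e' e\<close> together form a sum of defining relations. \<open>D\<close>
        measures the failure of \<open>\<theta> e'\<close> to be equivariant, and \<open>v\<close>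
        arises from bracketing the terms of \<open>C\<close>.\<close>
      define G where "G e e' = (\<Sum>k<n. \<mu> (\<theta> e (s k)) \<otimes>\<^sub>t \<theta> e' (t k))" for e e'
      define G' where "G' e e' = (\<Sum>k<n. \<theta> e' (s k) \<otimes>\<^sub>t \<mu> (\<theta> e (t k)))" for e e'
      define D where "D e e' w = \<theta> e' (br (snd e) w) - act2 (snd e) (\<theta> e' w)"
        for e e' :: "'v3 \<times> 'g" and w
      define v where "v = \<theta> e (snd e') - \<theta> e' (snd e)"
      have snd_b: "snd (?b e e') = br (snd e) (snd e')" for e e'
        by (simp add: abelian_ext_def split_def)
      have D_\<Phi>: "D e e' w - D e' e w = \<Phi> w (snd e) (snd e') - \<theta> (?b e e') w" for w
      proof -
        let ?X = "snd e" and ?Y = "snd e'" and ?h = "fst e" and ?h' = "fst e'"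
        \<comment> \<open>The element on the right is a lift of the first component of the bracket
          in general different from the one given by \<open>Q\<close>; under the action both
          agree.\<close>
        have "act2 w (Q (fst (?b e e'))) = act2 w (act2 ?X (Q ?h') - act2 ?Y (Q ?h) + \<omega> ?X ?Y)"
          by (rule act_section)
            (simp add: abelian_ext_def split_def assms(13) clinear_add[OF d] clinear_diff[OF d]
              d_act d_\<omega>)
        moreover have "\<omega> (br ?X w) ?Y = - \<omega> (br w ?X) ?Y" "\<omega> (br ?Y w) ?X = - \<omega> (br w ?Y) ?X"
          using br_swap[of ?X w] br_swap[of ?Y w] by (simp_all add: \<omega>_minus)
        moreover have "\<omega> w (br ?X ?Y) = - \<omega> (br ?X ?Y) w"
          by (rule \<omega>_swap)
        ultimately show ?thesis
          by (simp add: D_def \<theta>_def snd_b assms(15) ce_d2_def V2.act_bracket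
              clinear_add[OF act2(1)] clinear_diff[OF act2(1)] algebra_simps)
      qed
      \<comment> \<open>Invariance moves the bracket from \<open>s k\<close> to \<open>t k\<close>,
        where it joins the action term to form \<open>D\<close>; the action on \<open>one2\<close>
        vanishes.\<close>
      have diag_right: "diag_act (?b e) (act2 (snd e)) (fst (\<xi> e'))
          = G e e' + (\<Sum>k<n. j (s k) \<otimes>\<^sub>t D e e' (t k))
            - (j (br (snd e) (snd e')) - \<mu> (\<theta> e (snd e'))) \<otimes>\<^sub>t one2" for e e'
      proof -
        note lin = clinear_diag_act[OF b act2(1)]
        show ?thesis
          by (simp add: \<xi> clinear_diff[OF lin] clinear_minus[OF lin] clinear_sum[OF lin]
              diag_act_tmult[OF b act2(1)] bracket_j act_one tmult_diff_left sum.distrib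
              sum_subtractf invariant[OF j \<theta>] G_def D_def tmult_diff_right)
      qed
      have diag_left: "diag_act (act2 (snd e)) (?b e) (snd (\<xi> e'))
          = G' e e' + (\<Sum>k<n. D e e' (s k) \<otimes>\<^sub>t j (t k))
            - one2 \<otimes>\<^sub>t (j (br (snd e) (snd e')) - \<mu> (\<theta> e (snd e')))" for e e'
      proof -
        note lin = clinear_diag_act[OF act2(1) b]
        show ?thesis
          by (simp add: \<xi> clinear_diff[OF lin] clinear_minus[OF lin] clinear_sum[OF lin]
              diag_act_tmult[OF act2(1) b] bracket_j act_one tmult_diff_right sum.distrib
              sum_subtractf invariant[OF \<theta> j] G'_def D_def tmult_diff_left)
      qed
      have D_right: "(\<Sum>k<n. j (s k) \<otimes>\<^sub>t D e e' (t k)) - (\<Sum>k<n. j (s k) \<otimes>\<^sub>t D e' e (t k))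
          = j (br (snd e) (snd e')) \<otimes>\<^sub>t one2 - (\<Sum>k<n. j (s k) \<otimes>\<^sub>t \<theta> (?b e e') (t k))"
        by (simp add: sum_subtractf[symmetric] tmult_diff_right[symmetric] D_\<Phi>)
          (simp add: tmult_diff_right sum_subtractf \<Phi>_right)
      have D_left: "(\<Sum>k<n. D e e' (s k) \<otimes>\<^sub>t j (t k)) - (\<Sum>k<n. D e' e (s k) \<otimes>\<^sub>t j (t k))
          = one2 \<otimes>\<^sub>t j (br (snd e) (snd e')) - (\<Sum>k<n. \<theta> (?b e e') (s k) \<otimes>\<^sub>t j (t k))"
        by (simp add: sum_subtractf[symmetric] tmult_diff_left[symmetric] D_\<Phi>)
          (simp add: tmult_diff_left sum_subtractf \<Phi>_left)
      \<comment> \<open>With this swap the two bracket terms paired with \<open>one2\<close> add up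
        to coefficient \<open>- 2\<close>. The hypothesis on \<open>\<Phi>\<close>, used in
        \<open>D_right\<close> and \<open>D_left\<close>, contributes \<open>+ 1\<close>, and what
        remains is the \<open>- 1\<close> in \<open>\<xi> (?b e e')\<close>.\<close>
      have j_swap: "j (br (snd e') (snd e)) = - j (br (snd e) (snd e'))"
        using br_swap[of "snd e'" "snd e"] by (simp add: clinear_minus[OF j])
      have \<mu>v: "\<mu> v = \<mu> (\<theta> e (snd e')) - \<mu> (\<theta> e' (snd e))"
        by (simp add: v_def clinear_diff[OF \<mu>_linear])
      \<comment> \<open>The difference is split into defining relations, nested so that they can be
        removed from the left. The last two involve \<open>one2\<close>: as
        \<open>\<mu> one2\<close> is zero, each of them has just one component,
        \<open>\<mu> v\<close> tensor \<open>one2\<close> and \<open>one2\<close> tensor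
        \<open>\<mu> v\<close> respectively.\<close>
      define R where "R = (\<Sum>k<n. (\<mu> (\<theta> e (s k)) \<otimes>\<^sub>t \<theta> e' (t k), - (\<theta> e (s k) \<otimes>\<^sub>t \<mu> (\<theta> e' (t k)))))
        + ((\<Sum>k<n. (\<mu> (- \<theta> e' (s k)) \<otimes>\<^sub>t \<theta> e (t k), - ((- \<theta> e' (s k)) \<otimes>\<^sub>t \<mu> (\<theta> e (t k)))))
        + ((\<mu> v \<otimes>\<^sub>t one2, - (v \<otimes>\<^sub>t \<mu> one2))
        + ((\<mu> one2 \<otimes>\<^sub>t (- v), - (one2 \<otimes>\<^sub>t \<mu> (- v))) + \<xi> (?b e e'))))"
      have "X.act_sum e (\<xi> e') - X.act_sum e' (\<xi> e)
          = (G e e' - G e' e + \<mu> v \<otimes>\<^sub>t one2 + fst (\<xi> (?b e e')),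
             G' e e' - G' e' e + one2 \<otimes>\<^sub>t \<mu> v + snd (\<xi> (?b e e')))"
        (is "_ = (?x, ?y)")
      proof -
        have "diag_act (?b e) (act2 (snd e)) (fst (\<xi> e'))
            - diag_act (?b e') (act2 (snd e')) (fst (\<xi> e)) = ?x"
          using D_right unfolding diag_right \<xi>[of "?b e e'"] fst_conv snd_b \<mu>v j_swap
          by (simp add: tmult_simps algebra_simps)
        moreover have "diag_act (act2 (snd e)) (?b e) (snd (\<xi> e'))
            - diag_act (act2 (snd e')) (?b e') (snd (\<xi> e)) = ?y"
          using D_left unfolding diag_left \<xi>[of "?b e e'"] snd_conv snd_b \<mu>v j_swap
          by (simp add: tmult_simps algebra_simps)
        ultimately show ?thesis
          by (simp add: X.act_sum_def split_def)
      qed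
      also have "\<dots> = R"
        by (rule prod_eqI)
          (simp_all add: R_def G_def G'_def Pair_sum \<mu>_one clinear_minus[OF \<mu>_linear]
            tmult_minus_left tmult_minus_right sum_negf)
      finally show ?thesis
        by (simp add: R_def X.to_U2_sum_relation X.to_U2_relation)
    qed
  qed
qed

end
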